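(* Let $\mathcal{H}$ be a separable Hilbert space and $\{\varphi_n\}_{n\in\mathbb{N}}\subset\mathcal{H}$. Assume that (a) each $\varphi_n$ is a function on a given set $\Omega$; (b) $\{\varphi_n\}$ is a frame in $\mathcal{H}$ in the sense that there are constants $0<B_1\le B_2<\infty$ such that $$B_1\|c\|_{2}^{2}\le \|T^{*}c\|_{\mathcal{H}}^{2}\le B_2\|c\|_{2}^{2}\quad\forall c\in l^{2},\qquad B_1\|f\|_{\mathcal{H}}^{2}\le \|Tf\|_{l^2}^{2}\le B_2\|f\|_{\mathcal{H}}^{2}\quad\forall f\in\mathcal{H};$$ (c) $(\varphi_n(t))_{n\in\mathbb{N}}\in l^{2}$ for all $t\in\Omega$. Then $\mathcal{H}$ is a reproducing kernel Hilbert space of functions on $\Omega$ with kernel $$K^{G}(s,t)=\langle l(s),\overline{G}^{\,-1}l(t)\rangle_{2}=l(s)^{*}\,\overline{G}^{\,-1}l(t),\qquad s,t\in\Omega,$$ where $l(t)=(\varphi_n(t))_{n\in\mathbb{N}}\in l^{2}$, $G=(\langle\varphi_n,\varphi_m\rangle_{\mathcal{H}})_{n,m}$ is the Gramian and $\overline{G}$ is its entrywise complex conjugate (so $\overline{G}=G$ in the real case). Moreover, $G$ defines a selfadjoint operator in $l^{2}$ with dense domain, and, writing $\mathcal{H}_{RK}$ for the reproducing kernel Hilbert space with kernel $K^{G}$, one gets an isometric isomorphism $$T_G:\mathcal{H}_{RK}\to\mathcal{H},\qquad T_G\Big(\sum_n c_n\varphi_n(\cdot)\Big)=T^{*}c,\qquad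 c=(c_n)\in l^{2}.$$
   Context: Scalars are real or complex; inner products are linear in the second variable and conjugate-linear in the first. $l^{2}=l^{2}(\mathbb{N})$, with inner product $\langle\cdot,\cdot\rangle_2$ and norm $\|\cdot\|_2$. The frame operators are $T:\mathcal{H}\to l^{2}$, $Tf=(\langle\varphi_n,f\rangle_{\mathcal{H}})_{n}$, and its adjoint $T^{*}:l^{2}\to\mathcal{H}$, $T^{*}c=\sum_n c_n\varphi_n$. The Gramian acts by $(Gc)_k=\sum_j\langle\varphi_k,\varphi_j\rangle_{\mathcal{H}}c_j$. Convention: the elements of $\mathcal{H}$ are functions on $\Omega$, and expansions in the $\varphi_n$ are evaluated pointwise, i.e. the element $f=T^{*}c\in\mathcal{H}$, $c\in l^2$, is the function $f(t)=\sum_n c_n\varphi_n(t)$, $t\in\Omega$. A reproducing kernel Hilbert space (RKHS) on $\Omega$ is a Hilbert space $\mathcal{H}$ of functions on $\Omega$ such that for every $t\in\Omega$ there is a (unique) $K_t\in\mathcal{H}$ with $f(t)=\langle K_t,f\rangle_{\mathcal{H}}$ for all $f\in\mathcal{H}$. It has kernel $K$ on $\Omega\times\Omega$ if $K_t=K(t,\cdot)$ for all $t\in\Omega$. *)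

theory Defs
  imports "HOL-Analysis.Analysis"
begin

section \<open>Scalars\<close>

text \<open>
  A common abstraction of the real and the complex numbers with their conjugation. The axioms force
  every \<open>x\<close> to be a root of the real polynomial \<open>X\<^sup>2 - (x + conjg x) X + |x|\<^sup>2\<close>, so that the reals and
  the complex numbers are, up to isomorphism, the only instances.
\<close>

class real_or_complex = real_normed_field + banach +
  fixes conjg :: "'a \<Rightarrow> 'a"
  assumes conjg_add: "conjg (x + y) = conjg x + conjg y"
    and conjg_mult: "conjg (x * y) = conjg x * conjg y"
    and conjg_conjg [simp]: "conjg (conjg x) = x"
    and conjg_scaleR_one: "conjg (r *\<^sub>R 1) = r *\<^sub>R 1"
    and conjg_mult_self_scaleR: "conjg x * x = (norm x)\<^sup>2 *\<^sub>R 1"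

instantiation real :: real_or_complex
begin

definition conjg_real :: "real \<Rightarrow> real" where
  "conjg_real x = x"

instance
  by standard (simp_all add: conjg_real_def power2_eq_square)

end

instantiation complex :: real_or_complex
begin

definition conjg_complex :: "complex \<Rightarrow> complex" where
  "conjg_complex x = cnj x"

instance
proof
  fix x :: complex
  show "conjg x * x = (norm x)\<^sup>2 *\<^sub>R 1"
    unfolding conjg_complex_def scaleR_conv_of_real complex_norm_square
    by (simp only: mult.commute mult_1_left)
qed (simp_all add: conjg_complex_def)

end

lemma conjg_of_real [simp]: "conjg (of_real r) = (of_real r :: 'a :: real_or_complex)"
  by (simp add: of_real_def conjg_scaleR_one)

lemma conjg_mult_self: "conjg x * x = of_real ((norm x)\<^sup>2)" for x :: "'a :: real_or_complex"
  by (simp add: of_real_def conjg_mult_self_scaleR)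

lemma add_conjg_real:
  fixes x :: "'a :: real_or_complex"
  shows "\<exists>r. x + conjg x = of_real r"
proof -
  have one: "conjg (1 :: 'a) = 1"
    using conjg_of_real [of 1, where ?'a = 'a] by simp
  have "of_real ((norm (1 + x))\<^sup>2) = conjg (1 + x) * (1 + x)"
    by (rule conjg_mult_self [symmetric])
  also have "\<dots> = 1 + (x + conjg x) + conjg x * x"
    by (simp add: conjg_add one distrib_left distrib_right)
  finally have "x + conjg x = of_real ((norm (1 + x))\<^sup>2 - 1 - (norm x)\<^sup>2)"
    unfolding conjg_mult_self of_real_diff of_real_1 by (simp add: algebra_simps)
  then show ?thesis ..
qed

lemma norm_conjg [simp]: "norm (conjg x) = norm x" for x :: "'a :: real_or_complex"
proof (cases "x = 0")
  case True
  then show ?thesis using conjg_of_real [of 0] by simp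
next
  case False
  have "norm (conjg x) * norm x = (norm x)\<^sup>2"
    unfolding norm_mult [symmetric] conjg_mult_self norm_of_real by simp
  with False show ?thesis by (simp add: power2_eq_square)
qed


section \<open>Hilbert spaces of functions\<close>

text \<open>
  Spaces of scalar functions on the set \<open>\<Omega>\<close> (the type \<^typ>\<open>'i\<close>), with pointwise linear structure.
  Both \<open>l\<^sup>2\<close> and spaces such as \<open>\<H>\<close> are of this form.
\<close>

definition fun_subspace :: "('i \<Rightarrow> 'k::real_or_complex) set \<Rightarrow> bool" where
  "fun_subspace V \<longleftrightarrow>
     (\<lambda>_. 0) \<in> V \<and>
     (\<forall>f\<in>V. \<forall>g\<in>V. (\<lambda>t. f t + g t) \<in> V) \<and>
     (\<forall>a. \<forall>f\<in>V. (\<lambda>t. a * f t) \<in> V)"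

definition fun_linear_on ::
  "('i \<Rightarrow> 'k::real_or_complex) set \<Rightarrow> (('i \<Rightarrow> 'k) \<Rightarrow> ('j \<Rightarrow> 'k)) \<Rightarrow> bool" where
  "fun_linear_on V U \<longleftrightarrow>
     (\<forall>f\<in>V. \<forall>g\<in>V. U (\<lambda>t. f t + g t) = (\<lambda>s. U f s + U g s)) \<and>
     (\<forall>a. \<forall>f\<in>V. U (\<lambda>t. a * f t) = (\<lambda>s. a * U f s))"

locale inner_product_function_space =
  fixes V :: "('i \<Rightarrow> 'k::real_or_complex) set"
    and ip :: "('i \<Rightarrow> 'k) \<Rightarrow> ('i \<Rightarrow> 'k) \<Rightarrow> 'k"
  assumes subspace: "fun_subspace V"
    and ip_conjg: "\<lbrakk>f \<in> V; g \<in> V\<rbrakk> \<Longrightarrow> ip g f = conjg (ip f g)"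
    and ip_add_right: "\<lbrakk>f \<in> V; g \<in> V; h \<in> V\<rbrakk> \<Longrightarrow> ip f (\<lambda>t. g t + h t) = ip f g + ip f h"
    and ip_scale_right: "\<lbrakk>f \<in> V; g \<in> V\<rbrakk> \<Longrightarrow> ip f (\<lambda>t. a * g t) = a * ip f g"
    and ip_self_nonneg: "f \<in> V \<Longrightarrow> \<exists>r\<ge>0. ip f f = of_real r"
    and ip_self_eq_0: "\<lbrakk>f \<in> V; ip f f = 0\<rbrakk> \<Longrightarrow> f = (\<lambda>_. 0)"

definition ip_norm :: "(('i \<Rightarrow> 'k::real_or_complex) \<Rightarrow> ('i \<Rightarrow> 'k) \<Rightarrow> 'k) \<Rightarrow> ('i \<Rightarrow> 'k) \<Rightarrow> real" where
  "ip_norm ip f = sqrt (norm (ip f f))"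

text \<open>
  \<^locale>\<open>Metric_space\<close> requires symmetry and nonnegativity also off the carrier, where an inner
  product is unconstrained; hence the case distinction.
\<close>

definition ip_dist ::
  "('i \<Rightarrow> 'k::real_or_complex) set \<Rightarrow> (('i \<Rightarrow> 'k) \<Rightarrow> ('i \<Rightarrow> 'k) \<Rightarrow> 'k) \<Rightarrow>
   ('i \<Rightarrow> 'k) \<Rightarrow> ('i \<Rightarrow> 'k) \<Rightarrow> real" where
  "ip_dist V ip f g = (if f \<in> V \<and> g \<in> V then ip_norm ip (\<lambda>t. f t - g t) else 0)"

abbreviation ip_topology ::
  "('i \<Rightarrow> 'k::real_or_complex) set \<Rightarrow> (('i \<Rightarrow> 'k) \<Rightarrow> ('i \<Rightarrow> 'k) \<Rightarrow> 'k) \<Rightarrow> ('i \<Rightarrow> 'k) topology" where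
  "ip_topology V ip \<equiv> Metric_space.mtopology V (ip_dist V ip)"

context inner_product_function_space
begin

lemma zero_mem: "(\<lambda>_. 0) \<in> V"
  and add_mem: "\<lbrakk>f \<in> V; g \<in> V\<rbrakk> \<Longrightarrow> (\<lambda>t. f t + g t) \<in> V"
  and scale_mem: "f \<in> V \<Longrightarrow> (\<lambda>t. a * f t) \<in> V"
  using subspace unfolding fun_subspace_def by blast+

lemma diff_scale_mem: "\<lbrakk>f \<in> V; g \<in> V\<rbrakk> \<Longrightarrow> (\<lambda>t. f t - a * g t) \<in> V"
  using add_mem [of f "\<lambda>t. (- a) * g t"] scale_mem [of g "- a"] by simp

lemma diff_mem: "\<lbrakk>f \<in> V; g \<in> V\<rbrakk> \<Longrightarrow> (\<lambda>t. f t - g t) \<in> V"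
  using diff_scale_mem [of f g 1] by simp

lemma ip_diff_scale_right:
  "\<lbrakk>f \<in> V; g \<in> V; h \<in> V\<rbrakk> \<Longrightarrow> ip f (\<lambda>t. g t - a * h t) = ip f g - a * ip f h"
  using ip_add_right [of f g "\<lambda>t. (- a) * h t"] ip_scale_right [of f h "- a"]
    scale_mem [of h "- a"] by simp

lemma ip_add_left:
  assumes f: "f \<in> V" and g: "g \<in> V" and h: "h \<in> V"
  shows "ip (\<lambda>t. f t + g t) h = ip f h + ip g h"
  unfolding ip_conjg [OF h add_mem [OF f g]] ip_add_right [OF h f g] conjg_add
    ip_conjg [OF h f] ip_conjg [OF h g] ..

lemma ip_zero_right: "f \<in> V \<Longrightarrow> ip f (\<lambda>_. 0) = 0"
  using ip_scale_right [of f f 0] by simp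

lemma ip_self: "f \<in> V \<Longrightarrow> ip f f = of_real ((ip_norm ip f)\<^sup>2)"
  using ip_self_nonneg [of f] by (auto simp: ip_norm_def)

lemma ip_Cauchy_Schwarz:
  assumes f: "f \<in> V" and g: "g \<in> V"
  shows "norm (ip f g) \<le> ip_norm ip f * ip_norm ip g"
proof (cases "ip g g = 0")
  case True
  then have "g = (\<lambda>_. 0)"
    using ip_self_eq_0 g by blast
  then show ?thesis
    using ip_zero_right [OF f] by (simp add: ip_norm_def)
next
  case False
  define a where "a = ip g f / ip g g"
  define h where "h = (\<lambda>t. f t - a * g t)"
  define F N where "F = (ip_norm ip f)\<^sup>2" and "N = (ip_norm ip g)\<^sup>2"
  have h: "h \<in> V"
    unfolding h_def by (rule diff_scale_mem [OF f g])
  have N: "N > 0"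
    using False by (simp add: N_def ip_norm_def)
  have "ip g h = 0"
    unfolding h_def using ip_diff_scale_right [OF g f g, of a] False by (simp add: a_def)
  then have hg: "ip h g = 0"
    using ip_conjg [OF g h] conjg_of_real [of 0] by simp
  have "a * ip f g = of_real ((norm (ip f g))\<^sup>2 / N)"
    using conjg_mult_self [of "ip f g"] ip_conjg [OF f g] ip_self [OF g]
    by (simp add: a_def N_def)
  then have fh: "ip f h = of_real (F - (norm (ip f g))\<^sup>2 / N)"
    unfolding h_def using ip_diff_scale_right [OF f f g, of a] ip_self [OF f] by (simp add: F_def)
  have "ip h h = ip h f - a * ip h g"
    using ip_diff_scale_right [OF h f g, of a] by (simp add: h_def)
  also have "\<dots> = of_real (F - (norm (ip f g))\<^sup>2 / N)"
    using hg ip_conjg [OF f h] by (simp add: fh del: of_real_diff)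
  finally have "F - (norm (ip f g))\<^sup>2 / N \<ge> 0"
    using ip_self_nonneg [OF h] of_real_eq_iff by metis
  then have "(norm (ip f g))\<^sup>2 \<le> F * N"
    using N by (simp add: field_simps)
  also have "\<dots> = (ip_norm ip f * ip_norm ip g)\<^sup>2"
    by (simp add: F_def N_def power_mult_distrib)
  finally show ?thesis
    by (rule power2_le_imp_le) (simp add: ip_norm_def)
qed

lemma ip_norm_triangle:
  assumes f: "f \<in> V" and g: "g \<in> V"
  shows "ip_norm ip (\<lambda>t. f t + g t) \<le> ip_norm ip f + ip_norm ip g"
proof -
  let ?h = "\<lambda>t. f t + g t"
  have h: "?h \<in> V"
    by (rule add_mem [OF f g])
  have "ip ?h ?h = (ip f f + ip f g) + (ip g f + ip g g)"
    by (simp add: ip_add_left [OF f g h] ip_add_right f g)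
  then have "(ip_norm ip ?h)\<^sup>2 = norm ((ip f f + ip f g) + (ip g f + ip g g))"
    by (simp add: ip_norm_def)
  also have "\<dots> \<le> (norm (ip f f) + norm (ip f g)) + (norm (ip g f) + norm (ip g g))"
    by (intro norm_triangle_mono norm_triangle_ineq)
  also have "\<dots> = (ip_norm ip f)\<^sup>2 + 2 * norm (ip f g) + (ip_norm ip g)\<^sup>2"
    using ip_conjg [OF f g] by (simp add: ip_norm_def)
  also have "\<dots> \<le> (ip_norm ip f + ip_norm ip g)\<^sup>2"
    using ip_Cauchy_Schwarz [OF f g] by (simp add: power2_sum)
  finally show ?thesis
    by (rule power2_le_imp_le) (simp add: ip_norm_def)
qed

lemma Metric_space_ip_dist: "Metric_space V (ip_dist V ip)"
proof
  fix f g
  show "0 \<le> ip_dist V ip f g"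
    by (simp add: ip_dist_def ip_norm_def)
  show "ip_dist V ip f g = ip_dist V ip g f"
  proof (cases "f \<in> V \<and> g \<in> V")
    case True
    let ?d = "\<lambda>t. f t - g t"
    have d: "?d \<in> V"
      using True diff_mem by blast
    have "(\<lambda>t. (- 1) * ?d t) = (\<lambda>t. g t - f t)"
      by simp
    then have *: "ip k (\<lambda>t. g t - f t) = - ip k ?d" if "k \<in> V" for k
      using ip_scale_right [OF that d, of "- 1"] by simp
    have d': "(\<lambda>t. g t - f t) \<in> V"
      using True diff_mem by blast
    have "norm (ip (\<lambda>t. g t - f t) (\<lambda>t. g t - f t)) = norm (ip (\<lambda>t. g t - f t) ?d)"
      using * [OF d'] by simp
    also have "\<dots> = norm (ip ?d (\<lambda>t. g t - f t))"
      using ip_conjg [OF d d'] by simp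
    also have "\<dots> = norm (ip ?d ?d)"
      using * [OF d] by simp
    finally show ?thesis
      by (simp add: ip_dist_def ip_norm_def)
  qed (auto simp: ip_dist_def)
next
  fix f g assume fg: "f \<in> V" "g \<in> V"
  show "ip_dist V ip f g = 0 \<longleftrightarrow> f = g"
  proof
    assume "ip_dist V ip f g = 0"
    then have "ip (\<lambda>t. f t - g t) (\<lambda>t. f t - g t) = 0"
      using fg by (simp add: ip_dist_def ip_norm_def)
    from ip_self_eq_0 [OF diff_mem [OF fg] this] show "f = g"
      by (simp add: fun_eq_iff)
  qed (simp add: ip_dist_def ip_norm_def ip_zero_right [OF zero_mem])
next
  fix f g h assume fgh: "f \<in> V" "g \<in> V" "h \<in> V"
  then show "ip_dist V ip f h \<le> ip_dist V ip f g + ip_dist V ip g h"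
    using ip_norm_triangle [OF diff_mem [of f g] diff_mem [of g h]] by (simp add: ip_dist_def)
qed

end

definition hilbert_function_space ::
  "('i \<Rightarrow> 'k::real_or_complex) set \<Rightarrow> (('i \<Rightarrow> 'k) \<Rightarrow> ('i \<Rightarrow> 'k) \<Rightarrow> 'k) \<Rightarrow> bool" where
  "hilbert_function_space V ip \<longleftrightarrow>
     inner_product_function_space V ip \<and> Metric_space.mcomplete V (ip_dist V ip)"

definition isometric_isomorphism ::
  "('i \<Rightarrow> 'k::real_or_complex) set \<Rightarrow> (('i \<Rightarrow> 'k) \<Rightarrow> ('i \<Rightarrow> 'k) \<Rightarrow> 'k) \<Rightarrow>
   ('j \<Rightarrow> 'k) set \<Rightarrow> (('j \<Rightarrow> 'k) \<Rightarrow> ('j \<Rightarrow> 'k) \<Rightarrow> 'k) \<Rightarrow> (('i \<Rightarrow> 'k) \<Rightarrow> ('j \<Rightarrow> 'k)) \<Rightarrow> bool" where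
  "isometric_isomorphism V ipV W ipW U \<longleftrightarrow>
     bij_betw U V W \<and> fun_linear_on V U \<and> (\<forall>f\<in>V. ip_norm ipW (U f) = ip_norm ipV f)"


section \<open>Reproducing kernel Hilbert spaces\<close>

definition rkhs ::
  "('o \<Rightarrow> 'k::real_or_complex) set \<Rightarrow> (('o \<Rightarrow> 'k) \<Rightarrow> ('o \<Rightarrow> 'k) \<Rightarrow> 'k) \<Rightarrow> bool" where
  "rkhs V ip \<longleftrightarrow>
     hilbert_function_space V ip \<and> (\<forall>t. \<exists>!k. k \<in> V \<and> (\<forall>f\<in>V. f t = ip k f))"

definition repr_elem ::
  "('o \<Rightarrow> 'k::real_or_complex) set \<Rightarrow> (('o \<Rightarrow> 'k) \<Rightarrow> ('o \<Rightarrow> 'k) \<Rightarrow> 'k) \<Rightarrow> 'o \<Rightarrow> ('o \<Rightarrow> 'k)" where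
  "repr_elem V ip t = (THE k. k \<in> V \<and> (\<forall>f\<in>V. f t = ip k f))"

definition rkhs_with_kernel ::
  "('o \<Rightarrow> 'k::real_or_complex) set \<Rightarrow> (('o \<Rightarrow> 'k) \<Rightarrow> ('o \<Rightarrow> 'k) \<Rightarrow> 'k) \<Rightarrow> ('o \<Rightarrow> 'o \<Rightarrow> 'k) \<Rightarrow> bool" where
  "rkhs_with_kernel V ip K \<longleftrightarrow> rkhs V ip \<and> (\<forall>t. repr_elem V ip t = (\<lambda>s. K t s))"


section \<open>The sequence space and operators in it\<close>

definition l2 :: "(nat \<Rightarrow> 'k::real_or_complex) set" where
  "l2 = {c. summable (\<lambda>n. (norm (c n))\<^sup>2)}"

definition l2_ip :: "(nat \<Rightarrow> 'k::real_or_complex) \<Rightarrow> (nat \<Rightarrow> 'k) \<Rightarrow> 'k" where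
  "l2_ip c d = (\<Sum>n. conjg (c n) * d n)"

abbreviation l2_norm :: "(nat \<Rightarrow> 'k::real_or_complex) \<Rightarrow> real" where
  "l2_norm \<equiv> ip_norm l2_ip"

definition adjoint_graph ::
  "('i \<Rightarrow> 'k::real_or_complex) set \<Rightarrow> (('i \<Rightarrow> 'k) \<Rightarrow> ('i \<Rightarrow> 'k) \<Rightarrow> 'k) \<Rightarrow>
   ('i \<Rightarrow> 'k) set \<Rightarrow> (('i \<Rightarrow> 'k) \<Rightarrow> ('i \<Rightarrow> 'k)) \<Rightarrow> (('i \<Rightarrow> 'k) \<times> ('i \<Rightarrow> 'k)) set" where
  "adjoint_graph V ip D A =
     {(d, e). d \<in> V \<and> e \<in> V \<and> (\<forall>c\<in>D. ip d (A c) = ip e c)}"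

text \<open>
  \<open>A\<close> with domain \<open>D\<close> is a linear operator in \<open>V\<close>, \<open>D\<close> is dense in \<open>V\<close>, and \<open>A\<close> coincides with its adjoint
  (including the equality of the domains).
\<close>

definition selfadjoint_operator ::
  "('i \<Rightarrow> 'k::real_or_complex) set \<Rightarrow> (('i \<Rightarrow> 'k) \<Rightarrow> ('i \<Rightarrow> 'k) \<Rightarrow> 'k) \<Rightarrow>
   ('i \<Rightarrow> 'k) set \<Rightarrow> (('i \<Rightarrow> 'k) \<Rightarrow> ('i \<Rightarrow> 'k)) \<Rightarrow> bool" where
  "selfadjoint_operator V ip D A \<longleftrightarrow>
     D \<subseteq> V \<and> fun_subspace D \<and> A ` D \<subseteq> V \<and> fun_linear_on D A \<and>
     (ip_topology V ip) closure_of D = V \<and>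
     adjoint_graph V ip D A = (\<lambda>c. (c, A c)) ` D"

text \<open>The operator in \<open>l\<^sup>2\<close> defined by an infinite matrix, on its maximal domain.\<close>

definition matrix_op ::
  "(nat \<Rightarrow> nat \<Rightarrow> 'k::real_or_complex) \<Rightarrow> (nat \<Rightarrow> 'k) \<Rightarrow> (nat \<Rightarrow> 'k)" where
  "matrix_op M c = (\<lambda>k. \<Sum>j. M k j * c j)"

definition matrix_dom :: "(nat \<Rightarrow> nat \<Rightarrow> 'k::real_or_complex) \<Rightarrow> (nat \<Rightarrow> 'k) set" where
  "matrix_dom M = {c \<in> l2. (\<forall>k. summable (\<lambda>j. M k j * c j)) \<and> matrix_op M c \<in> l2}"

definition matrix_inverse ::
  "(nat \<Rightarrow> nat \<Rightarrow> 'k::real_or_complex) \<Rightarrow> (nat \<Rightarrow> 'k) \<Rightarrow> (nat \<Rightarrow> 'k)" where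
  "matrix_inverse M = inv_into (matrix_dom M) (matrix_op M)"

definition matrix_conjg :: "(nat \<Rightarrow> nat \<Rightarrow> 'k::real_or_complex) \<Rightarrow> nat \<Rightarrow> nat \<Rightarrow> 'k" where
  "matrix_conjg M = (\<lambda>n m. conjg (M n m))"


section \<open>Frames\<close>

definition analysis_op ::
  "(('o \<Rightarrow> 'k::real_or_complex) \<Rightarrow> ('o \<Rightarrow> 'k) \<Rightarrow> 'k) \<Rightarrow> (nat \<Rightarrow> ('o \<Rightarrow> 'k)) \<Rightarrow>
   ('o \<Rightarrow> 'k) \<Rightarrow> (nat \<Rightarrow> 'k)" where
  "analysis_op ip \<phi> f = (\<lambda>n. ip (\<phi> n) f)"

text \<open>\<open>T\<^sup>* c\<close>: the sum of \<open>\<Sum>n. c\<^sub>n \<phi>\<^sub>n\<close> in the norm of the Hilbert space (not the pointwise sum).\<close>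

definition synthesis_op ::
  "('o \<Rightarrow> 'k::real_or_complex) set \<Rightarrow> (('o \<Rightarrow> 'k) \<Rightarrow> ('o \<Rightarrow> 'k) \<Rightarrow> 'k) \<Rightarrow> (nat \<Rightarrow> ('o \<Rightarrow> 'k)) \<Rightarrow>
   (nat \<Rightarrow> 'k) \<Rightarrow> ('o \<Rightarrow> 'k)" where
  "synthesis_op V ip \<phi> c =
     (THE f. limitin (ip_topology V ip) (\<lambda>N t. \<Sum>n<N. c n * \<phi> n t) f sequentially)"

definition pointwise_sum ::
  "(nat \<Rightarrow> ('o \<Rightarrow> 'k::real_or_complex)) \<Rightarrow> (nat \<Rightarrow> 'k) \<Rightarrow> ('o \<Rightarrow> 'k)" where
  "pointwise_sum \<phi> c = (\<lambda>t. \<Sum>n. c n * \<phi> n t)"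

text \<open>
  The two-sided bounds on \<open>T\<^sup>*\<close> are part of the definition, so these are Riesz bases. That the series
  defining \<open>T\<^sup>* c\<close> converges for all \<open>c \<in> l\<^sup>2\<close> is not assumed: it follows from the upper bound on \<open>T\<close>
  and completeness.
\<close>

definition frame ::
  "('o \<Rightarrow> 'k::real_or_complex) set \<Rightarrow> (('o \<Rightarrow> 'k) \<Rightarrow> ('o \<Rightarrow> 'k) \<Rightarrow> 'k) \<Rightarrow> (nat \<Rightarrow> ('o \<Rightarrow> 'k)) \<Rightarrow>
   bool" where
  "frame V ip \<phi> \<longleftrightarrow>
     (\<forall>n. \<phi> n \<in> V) \<and> (\<forall>f\<in>V. analysis_op ip \<phi> f \<in> l2) \<and>
     (\<exists>B1 B2. 0 < B1 \<and> B1 \<le> B2 \<and>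
        (\<forall>c\<in>l2. B1 * (l2_norm c)\<^sup>2 \<le> (ip_norm ip (synthesis_op V ip \<phi> c))\<^sup>2 \<and>
                (ip_norm ip (synthesis_op V ip \<phi> c))\<^sup>2 \<le> B2 * (l2_norm c)\<^sup>2) \<and>
        (\<forall>f\<in>V. B1 * (ip_norm ip f)\<^sup>2 \<le> (l2_norm (analysis_op ip \<phi> f))\<^sup>2 \<and>
                (l2_norm (analysis_op ip \<phi> f))\<^sup>2 \<le> B2 * (ip_norm ip f)\<^sup>2))"

definition gramian ::
  "(('o \<Rightarrow> 'k::real_or_complex) \<Rightarrow> ('o \<Rightarrow> 'k) \<Rightarrow> 'k) \<Rightarrow> (nat \<Rightarrow> ('o \<Rightarrow> 'k)) \<Rightarrow> nat \<Rightarrow> nat \<Rightarrow> 'k" where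
  "gramian ip \<phi> = (\<lambda>n m. ip (\<phi> n) (\<phi> m))"

definition gram_kernel ::
  "(('o \<Rightarrow> 'k::real_or_complex) \<Rightarrow> ('o \<Rightarrow> 'k) \<Rightarrow> 'k) \<Rightarrow> (nat \<Rightarrow> ('o \<Rightarrow> 'k)) \<Rightarrow> 'o \<Rightarrow> 'o \<Rightarrow> 'k" where
  "gram_kernel ip \<phi> s t =
     l2_ip (\<lambda>n. \<phi> n s) (matrix_inverse (matrix_conjg (gramian ip \<phi>)) (\<lambda>n. \<phi> n t))"

end

theory Submission
  imports Defs
begin

text \<open>
  Write \<open>T\<close> for the analysis operator and \<open>T\<^sup>*\<close> for the synthesis operator. The lower bounds make both
  injective. Both are also surjective: the frame operator \<open>S = T\<^sup>* T\<close> satisfies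
  \<open>\<langle>h, S h\<rangle> = \<parallel>T h\<parallel>\<^sup>2 \<ge> B1 \<parallel>h\<parallel>\<^sup>2\<close>, so that for a suitable \<open>\<tau>\<close> the map \<open>f \<mapsto> f - \<tau> (S f - y)\<close> is a
  contraction, whose fixed point solves \<open>S f = y\<close> (\<open>frame_op_surj\<close>). Hence the Gramian \<open>G = T T\<^sup>*\<close> is an
  everywhere defined symmetric bijection of \<open>l\<^sup>2\<close>. Being symmetric and everywhere defined, it is
  selfadjoint. The matrix with conjugated entries acts as \<open>G\<close> between two entrywise conjugations of
  sequences, so it is a bijection of \<open>l\<^sup>2\<close> as well.

  For the kernel, let \<open>d\<^sub>t\<close> be the preimage of \<open>l(t)\<close> under the conjugated Gramian and let \<open>k\<^sub>t\<close> be \<open>T\<^sup>*\<close>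
  of the conjugate of \<open>d\<^sub>t\<close>. Then \<open>T k\<^sub>t\<close> is the conjugate of \<open>l(t)\<close>, so for every \<open>f = T\<^sup>* e\<close> the
  adjoint relation gives \<open>\<langle>k\<^sub>t, f\<rangle> = \<langle>T k\<^sub>t, e\<rangle>\<^sub>2 = \<Sum>\<^sub>n \<phi>\<^sub>n(t) e\<^sub>n = f(t)\<close>; the last equality is where pointwise
  evaluation of expansions enters. Expanding \<open>k\<^sub>t(s)\<close> gives the stated kernel (\<open>rkhs_gram_kernel\<close>).

  Finally, a reproducing kernel Hilbert space is determined by its kernel, both as a set of functions
  and in its norm (\<open>rkhs_with_kernel_unique\<close>). So any space with this kernel is the given one, which
  is the range of \<open>T\<^sup>*\<close>, and the isometric isomorphism is the identity map.
\<close>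

section \<open>Conjugation\<close>

lemma conjg_0 [simp]: "conjg (0 :: 'k::real_or_complex) = 0"
  using conjg_of_real [of 0, where ?'a = 'k] by simp

lemma bounded_linear_conjg: "bounded_linear (conjg :: 'k::real_or_complex \<Rightarrow> 'k)"
proof (rule bounded_linear_intro [where K = 1])
  fix r :: real and x :: 'k
  have "conjg (of_real r * x) = of_real r * conjg x"
    by (simp only: conjg_mult conjg_of_real)
  then show "conjg (r *\<^sub>R x) = r *\<^sub>R conjg x"
    by (simp add: scaleR_conv_of_real)
qed (simp_all add: conjg_add)


section \<open>The sequence space as an inner product space\<close>

text \<open>
  Products of square summable sequences are dominated by the sum of the squares; this makes every
  series in \<open>l2_ip\<close> absolutely convergent.
\<close>

lemma l2_summable_mult:
  fixes c d :: "nat \<Rightarrow> 'k::real_or_complex"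
  assumes "c \<in> l2" and "d \<in> l2"
  shows "summable (\<lambda>n. norm (c n) * norm (d n))"
proof (rule summable_comparison_test')
  show "summable (\<lambda>n. (norm (c n))\<^sup>2 + (norm (d n))\<^sup>2)"
    using assms by (simp add: l2_def summable_add)
  fix n
  have "0 \<le> norm (c n) * norm (d n)"
    by simp
  then have "norm (c n) * norm (d n) \<le> (norm (c n))\<^sup>2 + (norm (d n))\<^sup>2"
    using sum_squares_bound [of "norm (c n)" "norm (d n)"] by linarith
  then show "norm (norm (c n) * norm (d n)) \<le> (norm (c n))\<^sup>2 + (norm (d n))\<^sup>2"
    by simp
qed

lemma l2_conjg: "c \<in> l2 \<Longrightarrow> (\<lambda>n. conjg (c n)) \<in> l2"
  by (simp add: l2_def)

lemma l2_mult_summable: "c \<in> l2 \<Longrightarrow> d \<in> l2 \<Longrightarrow> summable (\<lambda>n. c n * d n)"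
  using l2_summable_mult [of c d] summable_norm_cancel [of "\<lambda>n. c n * d n"] by (simp add: norm_mult)

lemma l2_ip_summable: "c \<in> l2 \<Longrightarrow> d \<in> l2 \<Longrightarrow> summable (\<lambda>n. conjg (c n) * d n)"
  by (intro l2_mult_summable l2_conjg)

lemma l2_ip_self:
  assumes "c \<in> l2"
  shows "l2_ip c c = of_real (\<Sum>n. (norm (c n))\<^sup>2)"
  using assms unfolding l2_ip_def conjg_mult_self
  by (subst suminf_of_real) (simp_all add: l2_def)

lemma l2_norm_square:
  assumes "c \<in> l2"
  shows "(l2_norm c)\<^sup>2 = (\<Sum>n. (norm (c n))\<^sup>2)"
proof -
  have "0 \<le> (\<Sum>n. (norm (c n))\<^sup>2)"
    using assms by (intro suminf_nonneg) (simp_all add: l2_def)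
  then show ?thesis
    by (simp add: ip_norm_def l2_ip_self [OF assms])
qed

lemma fun_subspace_l2: "fun_subspace (l2 :: (nat \<Rightarrow> 'k::real_or_complex) set)"
  unfolding fun_subspace_def
proof (intro conjI ballI allI)
  show "(\<lambda>_. 0) \<in> (l2 :: (nat \<Rightarrow> 'k) set)"
    by (simp add: l2_def)
next
  fix c d :: "nat \<Rightarrow> 'k" assume cd: "c \<in> l2" "d \<in> l2"
  have "summable (\<lambda>n. (norm (c n + d n))\<^sup>2)"
  proof (rule summable_comparison_test')
    show "summable (\<lambda>n. 2 * (norm (c n))\<^sup>2 + 2 * (norm (d n))\<^sup>2)"
      using cd by (simp add: l2_def summable_add summable_mult)
    fix n
    have "(norm (c n + d n))\<^sup>2 \<le> (norm (c n) + norm (d n))\<^sup>2"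
      by (simp add: norm_triangle_ineq power_mono)
    also have "\<dots> \<le> 2 * (norm (c n))\<^sup>2 + 2 * (norm (d n))\<^sup>2"
      using sum_squares_bound [of "norm (c n)" "norm (d n)"] by (simp add: power2_sum)
    finally show "norm ((norm (c n + d n))\<^sup>2) \<le> 2 * (norm (c n))\<^sup>2 + 2 * (norm (d n))\<^sup>2"
      by simp
  qed
  then show "(\<lambda>n. c n + d n) \<in> l2"
    by (simp add: l2_def)
next
  fix a and c :: "nat \<Rightarrow> 'k" assume "c \<in> l2"
  then show "(\<lambda>n. a * c n) \<in> l2"
    by (simp add: l2_def norm_mult power_mult_distrib summable_mult)
qed

lemma inner_product_function_space_l2:
  "inner_product_function_space (l2 :: (nat \<Rightarrow> 'k::real_or_complex) set) l2_ip"
proof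
  show "fun_subspace (l2 :: (nat \<Rightarrow> 'k) set)"
    by (rule fun_subspace_l2)
next
  fix c d :: "nat \<Rightarrow> 'k" assume cd: "c \<in> l2" "d \<in> l2"
  have "conjg (l2_ip c d) = (\<Sum>n. conjg (conjg (c n) * d n))"
    unfolding l2_ip_def
    by (rule bounded_linear.suminf [OF bounded_linear_conjg l2_ip_summable [OF cd]])
  then show "l2_ip d c = conjg (l2_ip c d)"
    by (simp add: l2_ip_def conjg_mult mult.commute)
next
  fix c d e :: "nat \<Rightarrow> 'k" assume "c \<in> l2" "d \<in> l2" "e \<in> l2"
  then show "l2_ip c (\<lambda>n. d n + e n) = l2_ip c d + l2_ip c e"
    unfolding l2_ip_def by (simp add: distrib_left suminf_add l2_ip_summable)
next
  fix a and c d :: "nat \<Rightarrow> 'k" assume "c \<in> l2" "d \<in> l2"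
  then show "l2_ip c (\<lambda>n. a * d n) = a * l2_ip c d"
    unfolding l2_ip_def mult.left_commute [of _ a] by (intro suminf_mult l2_ip_summable)
next
  fix c :: "nat \<Rightarrow> 'k" assume c: "c \<in> l2"
  then have sm: "summable (\<lambda>n. (norm (c n))\<^sup>2)"
    by (simp add: l2_def)
  show "\<exists>r\<ge>0. l2_ip c c = of_real r"
    using l2_ip_self [OF c] suminf_nonneg [OF sm] by auto
  assume "l2_ip c c = 0"
  then have "(\<Sum>n. (norm (c n))\<^sup>2) = 0"
    by (simp add: l2_ip_self [OF c])
  then show "c = (\<lambda>_. 0)"
    using suminf_eq_zero_iff [OF sm] by (simp add: fun_eq_iff)
qed

interpretation l2: inner_product_function_space l2 l2_ip
  by (rule inner_product_function_space_l2)


section \<open>Limits and density in inner product spaces\<close>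

context inner_product_function_space
begin

lemma ip_norm_nonneg [simp]: "0 \<le> ip_norm ip f"
  by (simp add: ip_norm_def)

lemma ip_zero_left: "f \<in> V \<Longrightarrow> ip (\<lambda>_. 0) f = 0"
  using ip_conjg [of f "\<lambda>_. 0"] ip_zero_right [of f] zero_mem by simp

lemma ip_scale_left:
  assumes "f \<in> V" and "g \<in> V"
  shows "ip (\<lambda>t. a * f t) g = conjg a * ip f g"
  using ip_conjg [of g "\<lambda>t. a * f t"] ip_conjg [of g f] ip_scale_right [of g f a] assms
  by (simp add: conjg_mult scale_mem)

lemma ip_diff_right: "\<lbrakk>f \<in> V; g \<in> V; h \<in> V\<rbrakk> \<Longrightarrow> ip f (\<lambda>t. g t - h t) = ip f g - ip f h"
  using ip_diff_scale_right [of f g h 1] by simp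

lemma ip_diff_left:
  assumes "f \<in> V" and "g \<in> V" and "h \<in> V"
  shows "ip (\<lambda>t. f t - g t) h = ip f h - ip g h"
  using ip_add_left [of f "\<lambda>t. (- 1) * g t" h] ip_scale_left [of g h "- 1"]
    scale_mem [of g "- 1"] conjg_of_real [of "- 1", where ?'a = 'k] assms by simp

lemma ip_norm_scale:
  assumes "f \<in> V"
  shows "ip_norm ip (\<lambda>t. a * f t) = norm a * ip_norm ip f"
  using assms
  by (simp add: ip_norm_def ip_scale_left ip_scale_right scale_mem norm_mult real_sqrt_mult
      flip: power2_eq_square)

lemma ip_norm_eq_0: "f \<in> V \<Longrightarrow> ip_norm ip f = 0 \<Longrightarrow> f = (\<lambda>_. 0)"
  using ip_self_eq_0 [of f] by (simp add: ip_norm_def)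

text \<open>
  Testing against all vectors identifies a vector. This turns identities between vectors that are
  only known as limits into identities between scalars.
\<close>

lemma eq_of_ip_eq:
  assumes f: "f \<in> V" and g: "g \<in> V" and eq: "\<And>h. h \<in> V \<Longrightarrow> ip h f = ip h g"
  shows "f = g"
proof -
  have "(\<lambda>t. f t - g t) = (\<lambda>_. 0)"
    using ip_diff_right [OF diff_mem [OF f g] f g] eq [OF diff_mem [OF f g]]
    by (intro ip_self_eq_0 diff_mem f g) simp
  then show ?thesis
    by (simp add: fun_eq_iff)
qed

lemma ip_norm_diff_commute:
  assumes "f \<in> V" and "g \<in> V"
  shows "ip_norm ip (\<lambda>t. f t - g t) = ip_norm ip (\<lambda>t. g t - f t)"
  using Metric_space.commute [OF Metric_space_ip_dist, of f g] assms by (simp add: ip_dist_def)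

lemma abs_ip_norm_diff_le:
  assumes f: "f \<in> V" and g: "g \<in> V"
  shows "\<bar>ip_norm ip f - ip_norm ip g\<bar> \<le> ip_norm ip (\<lambda>t. f t - g t)"
  using ip_norm_triangle [OF diff_mem [OF f g] g] ip_norm_triangle [OF diff_mem [OF g f] f]
    ip_norm_diff_commute [OF f g] by simp

lemma limitin_ip_topology:
  assumes "\<And>n. F n \<in> V"
  shows "limitin (ip_topology V ip) F f sequentially \<longleftrightarrow>
           f \<in> V \<and> (\<lambda>n. ip_norm ip (\<lambda>t. F n t - f t)) \<longlonglongrightarrow> 0"
  using assms
  by (auto simp: Metric_space.limitin_metric_dist_null [OF Metric_space_ip_dist] ip_dist_def)

lemma tendsto_ip_right:
  assumes F: "\<And>n. F n \<in> V" and f: "f \<in> V" and g: "g \<in> V"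
    and lim: "(\<lambda>n. ip_norm ip (\<lambda>t. F n t - f t)) \<longlonglongrightarrow> 0"
  shows "(\<lambda>n. ip g (F n)) \<longlonglongrightarrow> ip g f"
proof -
  have "(\<lambda>n. ip g (F n) - ip g f) \<longlonglongrightarrow> 0"
  proof (rule Lim_null_comparison)
    show "(\<lambda>n. ip_norm ip g * ip_norm ip (\<lambda>t. F n t - f t)) \<longlonglongrightarrow> 0"
      using tendsto_mult_right_zero [OF lim] .
    show "\<forall>\<^sub>F n in sequentially.
        norm (ip g (F n) - ip g f) \<le> ip_norm ip g * ip_norm ip (\<lambda>t. F n t - f t)"
      using ip_Cauchy_Schwarz [OF g diff_mem [OF F f]] ip_diff_right [OF g F f] by simp
  qed
  then show ?thesis
    by (simp add: LIM_zero_iff)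
qed

lemma tendsto_ip_norm:
  assumes F: "\<And>n. F n \<in> V" and f: "f \<in> V"
    and lim: "(\<lambda>n. ip_norm ip (\<lambda>t. F n t - f t)) \<longlonglongrightarrow> 0"
  shows "(\<lambda>n. ip_norm ip (F n)) \<longlonglongrightarrow> ip_norm ip f"
proof -
  have "(\<lambda>n. ip_norm ip (F n) - ip_norm ip f) \<longlonglongrightarrow> 0"
    by (rule Lim_null_comparison [OF _ lim]) (simp add: abs_ip_norm_diff_le F f)
  then show ?thesis
    by (simp add: LIM_zero_iff)
qed

lemma ip_Cauchy_convergent:
  assumes complete: "Metric_space.mcomplete V (ip_dist V ip)"
    and F: "\<And>n. F n \<in> V"
    and Cauchy: "\<And>e. e > 0 \<Longrightarrow> \<exists>N. \<forall>m\<ge>N. \<forall>n\<ge>N. ip_norm ip (\<lambda>t. F m t - F n t) < e"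
  obtains f where "f \<in> V" and "(\<lambda>n. ip_norm ip (\<lambda>t. F n t - f t)) \<longlonglongrightarrow> 0"
proof -
  have "Metric_space.MCauchy V (ip_dist V ip) F"
    unfolding Metric_space.MCauchy_def [OF Metric_space_ip_dist]
    using F Cauchy by (auto simp: ip_dist_def image_subset_iff)
  then obtain f where "limitin (ip_topology V ip) F f sequentially"
    using complete unfolding Metric_space.mcomplete_def [OF Metric_space_ip_dist] by blast
  then show ?thesis
    using that limitin_ip_topology [of F f] F by blast
qed

lemma ip_convergent_imp_Cauchy:
  assumes F: "\<And>n. F n \<in> V" and f: "f \<in> V"
    and lim: "(\<lambda>n. ip_norm ip (\<lambda>t. F n t - f t)) \<longlonglongrightarrow> 0" and e: "e > 0"
  shows "\<exists>N. \<forall>m\<ge>N. \<forall>n\<ge>N. ip_norm ip (\<lambda>t. F m t - F n t) < e"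
proof -
  have "limitin (ip_topology V ip) F f sequentially"
    using limitin_ip_topology [of F f] F f lim by blast
  then have "Metric_space.MCauchy V (ip_dist V ip) F"
    using Metric_space.convergent_imp_MCauchy [OF Metric_space_ip_dist] F by blast
  then show ?thesis
    using e F unfolding Metric_space.MCauchy_def [OF Metric_space_ip_dist]
    by (simp add: ip_dist_def)
qed

lemma parallelogram:
  assumes f: "f \<in> V" and g: "g \<in> V"
  shows "(ip_norm ip (\<lambda>t. f t + g t))\<^sup>2 + (ip_norm ip (\<lambda>t. f t - g t))\<^sup>2
    = 2 * (ip_norm ip f)\<^sup>2 + 2 * (ip_norm ip g)\<^sup>2"
proof -
  have "of_real ((ip_norm ip (\<lambda>t. f t + g t))\<^sup>2 + (ip_norm ip (\<lambda>t. f t - g t))\<^sup>2)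
      = ip (\<lambda>t. f t + g t) (\<lambda>t. f t + g t) + ip (\<lambda>t. f t - g t) (\<lambda>t. f t - g t)"
    by (simp only: ip_self [OF add_mem [OF f g]] ip_self [OF diff_mem [OF f g]] of_real_add)
  also have "\<dots> = 2 * ip f f + 2 * ip g g"
    using f g by (simp add: ip_add_left ip_add_right ip_diff_left ip_diff_right add_mem diff_mem)
  also have "\<dots> = of_real (2 * (ip_norm ip f)\<^sup>2 + 2 * (ip_norm ip g)\<^sup>2)"
    by (simp add: ip_self f g)
  finally show ?thesis
    unfolding of_real_eq_iff .
qed

text \<open>
  Subtracting from \<open>h\<close> its component along \<open>w\<close> strictly shortens \<open>h\<close> unless the two are orthogonal:
  what remains is orthogonal to \<open>w\<close>, so Pythagoras applies.
\<close>

lemma ip_norm_diff_projection: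
  assumes h: "h \<in> V" and w: "w \<in> V" and nz: "ip w w \<noteq> 0"
  shows "(ip_norm ip (\<lambda>t. h t - (ip w h / ip w w) * w t))\<^sup>2
    = (ip_norm ip h)\<^sup>2 - (norm (ip w h))\<^sup>2 / (ip_norm ip w)\<^sup>2"
proof -
  define a where "a = ip w h / ip w w"
  define k where "k = (\<lambda>t. h t - a * w t)"
  have k: "k \<in> V"
    unfolding k_def by (rule diff_scale_mem [OF h w])
  have "ip w k = 0"
    unfolding k_def using ip_diff_scale_right [OF w h w, of a] nz by (simp add: a_def)
  then have kw: "ip k w = 0"
    using ip_conjg [OF w k] by simp
  have "ip k k = ip k h - a * ip k w"
    using ip_diff_scale_right [OF k h w, of a] by (simp add: k_def)
  also have "\<dots> = conjg (ip h k)"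
    using kw ip_conjg [OF h k] by simp
  also have "ip h k = ip h h - a * ip h w"
    unfolding k_def by (rule ip_diff_scale_right [OF h h w])
  also have "a * ip h w = of_real ((norm (ip w h))\<^sup>2 / (ip_norm ip w)\<^sup>2)"
    using conjg_mult_self [of "ip w h"] ip_conjg [OF w h] ip_self [OF w]
    by (simp add: a_def mult.commute)
  also have "conjg (ip h h - of_real ((norm (ip w h))\<^sup>2 / (ip_norm ip w)\<^sup>2))
      = of_real ((ip_norm ip h)\<^sup>2 - (norm (ip w h))\<^sup>2 / (ip_norm ip w)\<^sup>2)"
    unfolding ip_self [OF h] of_real_diff [symmetric] conjg_of_real ..
  finally have "of_real ((ip_norm ip k)\<^sup>2)
      = (of_real ((ip_norm ip h)\<^sup>2 - (norm (ip w h))\<^sup>2 / (ip_norm ip w)\<^sup>2) :: 'k)"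
    unfolding ip_self [OF k] .
  then show ?thesis
    unfolding of_real_eq_iff k_def a_def .
qed

text \<open>
  A minimizing sequence for the distance from \<open>f\<close> to \<open>W\<close> is Cauchy by the parallelogram law. Its limit
  \<open>g\<close> attains the minimal distance, so no multiple of an element of \<open>W\<close> can shorten \<open>f - g\<close>; hence
  \<open>f - g\<close> is orthogonal to \<open>W\<close> and therefore zero.
\<close>

lemma dense_if_orthogonal_trivial:
  assumes complete: "Metric_space.mcomplete V (ip_dist V ip)"
    and W: "fun_subspace W" "W \<subseteq> V"
    and trivial: "\<And>h. h \<in> V \<Longrightarrow> (\<And>w. w \<in> W \<Longrightarrow> ip w h = 0) \<Longrightarrow> h = (\<lambda>_. 0)"
    and f: "f \<in> V"
  obtains w where "\<And>n. w n \<in> W" and "(\<lambda>n. ip_norm ip (\<lambda>t. w n t - f t)) \<longlonglongrightarrow> 0"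
proof -
  define \<delta> where "\<delta> = (INF v\<in>W. (ip_norm ip (\<lambda>t. f t - v t))\<^sup>2)"
  have W0: "(\<lambda>_. 0) \<in> W"
    and Wadd: "\<And>u v. u \<in> W \<Longrightarrow> v \<in> W \<Longrightarrow> (\<lambda>t. u t + v t) \<in> W"
    and Wscale: "\<And>a u. u \<in> W \<Longrightarrow> (\<lambda>t. a * u t) \<in> W"
    using W(1) unfolding fun_subspace_def by blast+
  have WV: "v \<in> V" if "v \<in> W" for v
    using W(2) that by blast
  have bdd: "bdd_below ((\<lambda>v. (ip_norm ip (\<lambda>t. f t - v t))\<^sup>2) ` W)"
    by (rule bdd_belowI2 [where m = 0]) simp
  have lower: "\<delta> \<le> (ip_norm ip (\<lambda>t. f t - v t))\<^sup>2" if "v \<in> W" for v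
    unfolding \<delta>_def by (rule cINF_lower [OF bdd that])
  have "\<exists>v\<in>W. (ip_norm ip (\<lambda>t. f t - v t))\<^sup>2 < \<delta> + inverse (real (Suc n))" for n
  proof -
    have "\<delta> < \<delta> + inverse (real (Suc n))"
      by simp
    then show ?thesis
      unfolding \<delta>_def using cINF_less_iff [OF _ bdd] W0 by blast
  qed
  then obtain w where w: "\<And>n. w n \<in> W"
    and min: "\<And>n. (ip_norm ip (\<lambda>t. f t - w n t))\<^sup>2 < \<delta> + inverse (real (Suc n))"
    by metis
  have dist: "(ip_norm ip (\<lambda>t. w m t - w n t))\<^sup>2
      \<le> 2 * inverse (real (Suc m)) + 2 * inverse (real (Suc n))" for m n
  proof -
    let ?u = "\<lambda>t. f t - w m t" and ?v = "\<lambda>t. f t - w n t"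
    let ?c = "of_real (1 / 2) :: 'k"
    have V: "?u \<in> V" "?v \<in> V"
      using f w WV diff_mem by blast+
    \<comment> \<open>The midpoint of \<open>w m\<close> and \<open>w n\<close> lies in \<open>W\<close>, so its distance from \<open>f\<close> is bounded below.\<close>
    define mid where "mid = (\<lambda>t. ?c * (w m t + w n t))"
    have mid: "mid \<in> W"
      unfolding mid_def by (intro Wscale Wadd w)
    have "(\<lambda>t. ?u t + ?v t) = (\<lambda>t. 2 * (f t - mid t))"
      by (simp add: mid_def fun_eq_iff algebra_simps)
    then have "ip_norm ip (\<lambda>t. ?u t + ?v t) = 2 * ip_norm ip (\<lambda>t. f t - mid t)"
      using ip_norm_scale [OF diff_mem [OF f WV [OF mid]], of 2] by simp
    then have "4 * \<delta> \<le> (ip_norm ip (\<lambda>t. ?u t + ?v t))\<^sup>2"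
      using lower [OF mid] by (simp add: power_mult_distrib)
    moreover have "(\<lambda>t. ?v t - ?u t) = (\<lambda>t. w m t - w n t)"
      by simp
    ultimately show ?thesis
      using parallelogram [OF V(2) V(1)] min [of m] min [of n] by (simp add: add.commute)
  qed
  have "\<exists>N. \<forall>m\<ge>N. \<forall>n\<ge>N. ip_norm ip (\<lambda>t. w m t - w n t) < e" if e: "e > 0" for e
  proof -
    obtain N where N: "inverse (real (Suc N)) < e\<^sup>2 / 4"
      using reals_Archimedean [of "e\<^sup>2 / 4"] e by auto
    have "ip_norm ip (\<lambda>t. w m t - w n t) < e" if "m \<ge> N" "n \<ge> N" for m n
    proof -
      have "inverse (real (Suc m)) \<le> inverse (real (Suc N))"
        "inverse (real (Suc n)) \<le> inverse (real (Suc N))"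
        using that by (simp_all add: le_imp_inverse_le)
      then have "(ip_norm ip (\<lambda>t. w m t - w n t))\<^sup>2 < e\<^sup>2"
        using dist [of m n] N by linarith
      then show ?thesis
        using e by (simp add: power2_less_imp_less)
    qed
    then show ?thesis
      by blast
  qed
  then obtain g where g: "g \<in> V" and lim: "(\<lambda>n. ip_norm ip (\<lambda>t. w n t - g t)) \<longlonglongrightarrow> 0"
    by (rule ip_Cauchy_convergent [OF complete WV [OF w]])
  define h where "h = (\<lambda>t. f t - g t)"
  have h: "h \<in> V"
    unfolding h_def by (rule diff_mem [OF f g])
  \<comment> \<open>Used with \<open>u = 0\<close> for the minimality of \<open>h\<close>, and with multiples of \<open>v \<in> W\<close> for orthogonality.\<close>
  have lim_shift: "(\<lambda>n. ip_norm ip (\<lambda>t. f t - w n t - u t)) \<longlonglongrightarrow> ip_norm ip (\<lambda>t. h t - u t)"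
    if u: "u \<in> V" for u
  proof (rule tendsto_ip_norm)
    have "(\<lambda>t. f t - w n t - u t - (h t - u t)) = (\<lambda>t. g t - w n t)" for n
      by (simp add: h_def)
    then show "(\<lambda>n. ip_norm ip (\<lambda>t. f t - w n t - u t - (h t - u t))) \<longlonglongrightarrow> 0"
      using lim ip_norm_diff_commute [OF g WV [OF w]] by simp
  qed (intro diff_mem f WV w u h)+
  have norm_lim: "(\<lambda>n. (ip_norm ip (\<lambda>t. f t - w n t))\<^sup>2) \<longlonglongrightarrow> (ip_norm ip h)\<^sup>2"
    using tendsto_power [OF lim_shift [OF zero_mem], of 2] by simp
  have bound_lim: "(\<lambda>n. \<delta> + inverse (real (Suc n))) \<longlonglongrightarrow> \<delta>"
    using tendsto_add [OF tendsto_const LIMSEQ_inverse_real_of_nat, of \<delta>] by simp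
  have upper: "(ip_norm ip h)\<^sup>2 \<le> \<delta>"
    by (intro LIMSEQ_le [OF norm_lim bound_lim] exI [of _ 0] allI impI less_imp_le min)
  have "ip v h = 0" if v: "v \<in> W" for v
  proof (cases "ip v v = 0")
    case True
    then show ?thesis
      using ip_self_eq_0 [OF WV [OF v]] ip_zero_left [OF h] by blast
  next
    case False
    define a where "a = ip v h / ip v v"
    have "\<delta> \<le> (ip_norm ip (\<lambda>t. f t - w n t - a * v t))\<^sup>2" for n
      using lower [OF Wadd [OF w Wscale [OF v]], of n a] by (simp add: diff_diff_eq)
    then have "\<delta> \<le> (ip_norm ip (\<lambda>t. h t - a * v t))\<^sup>2"
      by (intro LIMSEQ_le_const [OF tendsto_power [OF lim_shift [OF scale_mem [OF WV [OF v]]]]] exI allI impI)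
    then have "(norm (ip v h))\<^sup>2 / (ip_norm ip v)\<^sup>2 \<le> 0"
      using upper ip_norm_diff_projection [OF h WV [OF v] False] by (simp add: a_def)
    moreover have "(ip_norm ip v)\<^sup>2 > 0"
      using False by (simp add: ip_norm_def)
    ultimately show ?thesis
      by (simp add: divide_le_0_iff)
  qed
  then have "h = (\<lambda>_. 0)"
    using trivial [OF h] by blast
  then have "f = g"
    by (simp add: h_def fun_eq_iff)
  then show ?thesis
    using that w lim by blast
qed

end


section \<open>A kernel determines its reproducing kernel Hilbert space\<close>

lemma rkhs_with_kernelD:
  assumes "rkhs_with_kernel V ip K"
  shows "hilbert_function_space V ip" and "K t \<in> V" and "f \<in> V \<Longrightarrow> f t = ip (K t) f"
proof -
  have ex1: "\<exists>!k. k \<in> V \<and> (\<forall>f\<in>V. f t = ip k f)" and repr: "repr_elem V ip t = K t"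
    using assms unfolding rkhs_with_kernel_def rkhs_def by auto
  have *: "K t \<in> V \<and> (\<forall>f\<in>V. f t = ip (K t) f)"
    using theI' [OF ex1] unfolding repr [symmetric] repr_elem_def .
  show "hilbert_function_space V ip"
    using assms unfolding rkhs_with_kernel_def rkhs_def by blast
  show "K t \<in> V" "f \<in> V \<Longrightarrow> f t = ip (K t) f"
    using * by blast+
qed

lemma rkhs_with_kernelI:
  assumes hilbert: "hilbert_function_space V ip"
    and mem: "\<And>t. K t \<in> V" and repr: "\<And>t f. f \<in> V \<Longrightarrow> f t = ip (K t) f"
  shows "rkhs_with_kernel V ip K"
proof -
  interpret inner_product_function_space V ip
    using hilbert unfolding hilbert_function_space_def by blast
  have uniq: "k = K t" if k: "k \<in> V" and eq: "\<forall>f\<in>V. f t = ip k f" for k t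
  proof (rule eq_of_ip_eq [OF k mem])
    fix h assume h: "h \<in> V"
    then have "ip k h = ip (K t) h"
      using eq repr [OF h, of t] by simp
    then show "ip h k = ip h (K t)"
      using ip_conjg [OF k h] ip_conjg [OF mem h] by simp
  qed
  have "repr_elem V ip t = K t" for t
    unfolding repr_elem_def using mem repr uniq by (intro the_equality) blast+
  moreover have "\<exists>!k. k \<in> V \<and> (\<forall>f\<in>V. f t = ip k f)" for t
    using mem repr uniq by (intro ex1I [of _ "K t"]) blast+
  ultimately show ?thesis
    using hilbert unfolding rkhs_with_kernel_def rkhs_def by simp
qed

text \<open>
  Let \<open>W\<close> consist of the common elements of both spaces on which the two inner products agree. It
  contains all \<open>K t\<close>, by the reproducing property on both sides, and an element orthogonal to all
  \<open>K t\<close> vanishes at every point, so \<open>W\<close> is dense in the first space. A sequence in \<open>W\<close> that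
  converges to \<open>f\<close> there is Cauchy for both norms, and its limit in the second space is again \<open>f\<close>
  since convergence in either norm implies pointwise convergence. Working with this \<open>W\<close> instead of
  the span of the \<open>K t\<close> spares computing inner products of linear combinations.
\<close>

lemma rkhs_with_same_kernel_subset:
  assumes K1: "rkhs_with_kernel V1 ip1 K" and K2: "rkhs_with_kernel V2 ip2 K" and f: "f \<in> V1"
  shows "f \<in> V2" and "ip_norm ip2 f = ip_norm ip1 f"
proof -
  note repr1 = rkhs_with_kernelD [OF K1] and repr2 = rkhs_with_kernelD [OF K2]
  interpret H1: inner_product_function_space V1 ip1
    using repr1(1) unfolding hilbert_function_space_def by blast
  interpret H2: inner_product_function_space V2 ip2
    using repr2(1) unfolding hilbert_function_space_def by blast
  define W where "W = {u \<in> V1 \<inter> V2. \<forall>g\<in>V1 \<inter> V2. ip1 g u = ip2 g u}"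
  have W: "fun_subspace W" "W \<subseteq> V1"
    unfolding fun_subspace_def W_def
    by (auto simp: H1.zero_mem H2.zero_mem H1.add_mem H2.add_mem H1.scale_mem H2.scale_mem
        H1.ip_zero_right H2.ip_zero_right H1.ip_add_right H2.ip_add_right
        H1.ip_scale_right H2.ip_scale_right)
  have K_W: "K t \<in> W" for t
  proof -
    have "ip1 g (K t) = ip2 g (K t)" if "g \<in> V1" "g \<in> V2" for g
      using H1.ip_conjg [OF repr1(2) that(1), of t] H2.ip_conjg [OF repr2(2) that(2), of t]
        repr1(3) [OF that(1), of t] repr2(3) [OF that(2), of t] by simp
    then show ?thesis
      by (simp add: W_def repr1(2) repr2(2))
  qed
  have trivial: "h = (\<lambda>_. 0)" if "h \<in> V1" "\<And>w. w \<in> W \<Longrightarrow> ip1 w h = 0" for h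
    using repr1(3) [OF that(1)] that(2) [OF K_W] by (simp add: fun_eq_iff)
  obtain w where w: "\<And>n. w n \<in> W" and lim1: "(\<lambda>n. ip_norm ip1 (\<lambda>t. w n t - f t)) \<longlonglongrightarrow> 0"
    using H1.dense_if_orthogonal_trivial [OF _ W trivial f] repr1(1)
    unfolding hilbert_function_space_def by blast
  have w1: "w n \<in> V1" and w2: "w n \<in> V2" for n
    using w by (auto simp: W_def)
  have norm_W: "ip_norm ip1 u = ip_norm ip2 u" if "u \<in> W" for u
    using that by (simp add: W_def ip_norm_def)
  have diff_W: "(\<lambda>t. w m t - w n t) \<in> W" for m n
  proof -
    have "(\<lambda>t. (- 1) * w n t) \<in> W"
      using W(1) w [of n] unfolding fun_subspace_def by fast
    then have "(\<lambda>t. w m t + (- 1) * w n t) \<in> W"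
      using W(1) w [of m] unfolding fun_subspace_def by fast
    then show ?thesis
      by simp
  qed
  have complete2: "Metric_space.mcomplete V2 (ip_dist V2 ip2)"
    using repr2(1) unfolding hilbert_function_space_def by blast
  have "\<exists>N. \<forall>m\<ge>N. \<forall>n\<ge>N. ip_norm ip2 (\<lambda>t. w m t - w n t) < e" if "e > 0" for e
    using H1.ip_convergent_imp_Cauchy [OF w1 f lim1 that] norm_W [OF diff_W] by simp
  then obtain g where g: "g \<in> V2" and lim2: "(\<lambda>n. ip_norm ip2 (\<lambda>t. w n t - g t)) \<longlonglongrightarrow> 0"
    by (rule H2.ip_Cauchy_convergent [OF complete2 w2])
  have "f t = g t" for t
  proof (rule LIMSEQ_unique)
    show "(\<lambda>n. w n t) \<longlonglongrightarrow> f t"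
      using H1.tendsto_ip_right [OF w1 f repr1(2) lim1, of t]
      by (simp flip: repr1(3) add: w1 f)
    show "(\<lambda>n. w n t) \<longlonglongrightarrow> g t"
      using H2.tendsto_ip_right [OF w2 g repr2(2) lim2, of t]
      by (simp flip: repr2(3) add: w2 g)
  qed
  then have fg: "f = g"
    by (rule ext)
  show "f \<in> V2"
    unfolding fg by (rule g)
  have "(\<lambda>n. ip_norm ip2 (w n)) \<longlonglongrightarrow> ip_norm ip1 f"
    using H1.tendsto_ip_norm [OF w1 f lim1] norm_W [OF w] by simp
  then show "ip_norm ip2 f = ip_norm ip1 f"
    using LIMSEQ_unique H2.tendsto_ip_norm [OF w2 g lim2] unfolding fg by blast
qed

lemma rkhs_with_kernel_unique:
  assumes "rkhs_with_kernel V1 ip1 K" and "rkhs_with_kernel V2 ip2 K"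
  shows "V1 = V2" and "f \<in> V1 \<Longrightarrow> ip_norm ip2 f = ip_norm ip1 f"
  using rkhs_with_same_kernel_subset assms by blast+


section \<open>Synthesis and analysis operators of a Riesz basis\<close>

text \<open>
  The two-sided bounds for one fixed choice of constants. Those for the synthesis operator express
  that the system is a Riesz basis, which is more than the usual notion of a frame.
\<close>

locale riesz_basis = inner_product_function_space V ip
  for V :: "('o \<Rightarrow> 'k::real_or_complex) set" and ip +
  fixes \<phi> :: "nat \<Rightarrow> 'o \<Rightarrow> 'k" and B1 B2 :: real
  assumes complete: "Metric_space.mcomplete V (ip_dist V ip)"
    and basis_mem: "\<phi> n \<in> V"
    and bounds: "0 < B1" "B1 \<le> B2"
    and analysis_l2: "f \<in> V \<Longrightarrow> analysis_op ip \<phi> f \<in> l2"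
    and synthesis_lower:
      "c \<in> l2 \<Longrightarrow> B1 * (l2_norm c)\<^sup>2 \<le> (ip_norm ip (synthesis_op V ip \<phi> c))\<^sup>2"
    and synthesis_upper:
      "c \<in> l2 \<Longrightarrow> (ip_norm ip (synthesis_op V ip \<phi> c))\<^sup>2 \<le> B2 * (l2_norm c)\<^sup>2"
    and analysis_lower:
      "f \<in> V \<Longrightarrow> B1 * (ip_norm ip f)\<^sup>2 \<le> (l2_norm (analysis_op ip \<phi> f))\<^sup>2"
    and analysis_upper:
      "f \<in> V \<Longrightarrow> (l2_norm (analysis_op ip \<phi> f))\<^sup>2 \<le> B2 * (ip_norm ip f)\<^sup>2"
begin

abbreviation synthesis :: "(nat \<Rightarrow> 'k) \<Rightarrow> 'o \<Rightarrow> 'k" where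
  "synthesis \<equiv> synthesis_op V ip \<phi>"

abbreviation analysis :: "('o \<Rightarrow> 'k) \<Rightarrow> nat \<Rightarrow> 'k" where
  "analysis \<equiv> analysis_op ip \<phi>"

lemma sum_mem: "finite A \<Longrightarrow> (\<lambda>t. \<Sum>n\<in>A. c n * \<phi> n t) \<in> V"
  by (induction A rule: finite_induct) (simp_all add: zero_mem add_mem scale_mem basis_mem)

lemma ip_sum_right:
  assumes "finite A" and g: "g \<in> V"
  shows "ip g (\<lambda>t. \<Sum>n\<in>A. c n * \<phi> n t) = (\<Sum>n\<in>A. c n * ip g (\<phi> n))"
  using assms(1)
proof (induction A rule: finite_induct)
  case (insert n A)
  then show ?case
    using ip_add_right [OF g scale_mem [OF basis_mem] sum_mem, of A "c n" n c]
    by (simp add: ip_scale_right g basis_mem)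
qed (simp add: ip_zero_right g)

text \<open>
  The upper bound for the analysis operator, transported to finite synthesis sums by duality: for
  such a sum \<open>s\<close>, \<open>\<parallel>s\<parallel>\<^sup>2 = \<Sum>\<^sub>n c\<^sub>n \<langle>s, \<phi>\<^sub>n\<rangle>\<close> is at most \<open>\<parallel>c\<parallel> \<parallel>T s\<parallel> \<le> \<parallel>c\<parallel> \<surd>B2 \<parallel>s\<parallel>\<close>. The assumed bound for
  the synthesis operator cannot serve here: it says something about the sum of the series only once the
  series is known to converge.
\<close>

lemma sum_Bessel:
  assumes A: "finite A"
  shows "(ip_norm ip (\<lambda>t. \<Sum>n\<in>A. c n * \<phi> n t))\<^sup>2 \<le> B2 * (\<Sum>n\<in>A. (norm (c n))\<^sup>2)"
proof -
  define s where "s = (\<lambda>t. \<Sum>n\<in>A. c n * \<phi> n t)"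
  define C where "C = (\<Sum>n\<in>A. (norm (c n))\<^sup>2)"
  define r where "r = (ip_norm ip s)\<^sup>2"
  have s: "s \<in> V"
    unfolding s_def by (rule sum_mem [OF A])
  have "r = norm (ip s s)"
    by (simp add: r_def ip_norm_def)
  also have "ip s s = (\<Sum>n\<in>A. c n * ip s (\<phi> n))"
    using ip_sum_right [OF A s, of c] by (simp only: s_def [symmetric])
  also have "norm \<dots> \<le> (\<Sum>n\<in>A. norm (c n) * norm (analysis s n))"
    using ip_conjg [OF basis_mem s]
    by (intro sum_norm_le) (simp add: norm_mult analysis_op_def)
  finally have "r\<^sup>2 \<le> (\<Sum>n\<in>A. norm (c n) * norm (analysis s n))\<^sup>2"
    by (intro power_mono) (simp_all add: r_def)
  also have "\<dots> \<le> C * (\<Sum>n\<in>A. (norm (analysis s n))\<^sup>2)"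
    unfolding C_def by (rule Cauchy_Schwarz_ineq_sum)
  also have "\<dots> \<le> C * (l2_norm (analysis s))\<^sup>2"
    unfolding l2_norm_square [OF analysis_l2 [OF s]]
    using analysis_l2 [OF s] A
    by (intro mult_left_mono sum_le_suminf) (simp_all add: l2_def C_def sum_nonneg)
  also have "\<dots> \<le> C * (B2 * r)"
    unfolding r_def by (intro mult_left_mono analysis_upper s) (simp add: C_def sum_nonneg)
  finally have *: "r * r \<le> (B2 * C) * r"
    by (simp add: power2_eq_square mult_ac)
  have "r \<le> B2 * C"
  proof (cases "r = 0")
    case True
    have "0 \<le> C"
      by (simp add: C_def sum_nonneg)
    with True bounds show ?thesis
      by simp
  next
    case False
    then have "r > 0"
      by (simp add: r_def)
    then show ?thesis
      using * by simp
  qed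
  then show ?thesis
    by (simp add: r_def s_def C_def)
qed

text \<open>
  The definite description in \<open>synthesis_op\<close> is justified: by \<open>sum_Bessel\<close> the partial sums are Cauchy,
  and limits in norm are unique.
\<close>

lemma synthesis_limit:
  assumes c: "c \<in> l2"
  shows "synthesis c \<in> V"
    and "(\<lambda>N. ip_norm ip (\<lambda>t. (\<Sum>n<N. c n * \<phi> n t) - synthesis c t)) \<longlonglongrightarrow> 0"
proof -
  define P where "P = (\<lambda>N t. \<Sum>n<N. c n * \<phi> n t)"
  have P: "P N \<in> V" for N
    unfolding P_def by (rule sum_mem) simp
  have "\<exists>N. \<forall>m\<ge>N. \<forall>n\<ge>N. ip_norm ip (\<lambda>t. P m t - P n t) < e" if e: "e > 0" for e
  proof -
    have "0 < e\<^sup>2 / B2"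
      using e bounds by simp
    then obtain N where N: "\<And>m n. m \<ge> N \<Longrightarrow> norm (\<Sum>k=m..<n. (norm (c k))\<^sup>2) < e\<^sup>2 / B2"
      using c unfolding l2_def mem_Collect_eq summable_Cauchy by blast
    have less: "ip_norm ip (\<lambda>t. P n t - P m t) < e" if "N \<le> m" "m \<le> n" for m n
    proof -
      have "(\<lambda>t. P n t - P m t) = (\<lambda>t. \<Sum>k=m..<n. c k * \<phi> k t)"
        unfolding P_def using that(2)
        by (simp add: fun_eq_iff sum_diff_nat_ivl lessThan_atLeast0)
      then have "(ip_norm ip (\<lambda>t. P n t - P m t))\<^sup>2 \<le> B2 * (\<Sum>k=m..<n. (norm (c k))\<^sup>2)"
        using sum_Bessel [of "{m..<n}" c] by simp
      also have "\<dots> < e\<^sup>2"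
        using N [OF that(1), of n] bounds by (simp add: field_simps sum_nonneg)
      finally show ?thesis
        using e by (simp add: power2_less_imp_less)
    qed
    have "ip_norm ip (\<lambda>t. P m t - P n t) < e" if "N \<le> m" "N \<le> n" for m n
      using less [OF that(1), of n] less [OF that(2), of m] ip_norm_diff_commute [OF P P, of m n]
      by (cases "m \<le> n") simp_all
    then show ?thesis
      by blast
  qed
  then obtain f where f: "f \<in> V" and lim: "(\<lambda>N. ip_norm ip (\<lambda>t. P N t - f t)) \<longlonglongrightarrow> 0"
    by (rule ip_Cauchy_convergent [OF complete P])
  have limitin: "limitin (ip_topology V ip) P f sequentially"
    using limitin_ip_topology [of P f] P f lim by blast
  have "synthesis c = f"
    unfolding synthesis_op_def P_def [symmetric]
  proof (rule the_equality)
    show "limitin (ip_topology V ip) P f sequentially"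
      by (rule limitin)
    show "g = f" if "limitin (ip_topology V ip) P g sequentially" for g
      by (rule Metric_space.limitin_metric_unique [OF Metric_space_ip_dist that limitin]) simp
  qed
  then show "synthesis c \<in> V"
    and "(\<lambda>N. ip_norm ip (\<lambda>t. (\<Sum>n<N. c n * \<phi> n t) - synthesis c t)) \<longlonglongrightarrow> 0"
    using f lim by (simp_all add: P_def)
qed

lemma ip_synthesis_sums:
  assumes c: "c \<in> l2" and g: "g \<in> V"
  shows "(\<lambda>n. c n * ip g (\<phi> n)) sums ip g (synthesis c)"
  using tendsto_ip_right [OF sum_mem synthesis_limit(1) [OF c] g synthesis_limit(2) [OF c]]
  by (simp add: sums_def ip_sum_right g)

text \<open>
  This is what makes \<open>T\<^sup>*\<close> the adjoint of \<open>T\<close>. Linearity of \<open>T\<^sup>*\<close>, symmetry of the Gramian and the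
  reproducing property are all read off from it, with no further recourse to limits.
\<close>

lemma ip_synthesis:
  assumes c: "c \<in> l2" and g: "g \<in> V"
  shows "ip g (synthesis c) = l2_ip (analysis g) c"
proof -
  have "c n * ip g (\<phi> n) = conjg (analysis g n) * c n" for n
    using ip_conjg [OF basis_mem g] by (simp add: analysis_op_def)
  then show ?thesis
    using sums_unique [OF ip_synthesis_sums [OF c g]] by (simp only: l2_ip_def)
qed

lemma analysis_diff:
  "f \<in> V \<Longrightarrow> g \<in> V \<Longrightarrow> analysis (\<lambda>t. f t - g t) = (\<lambda>n. analysis f n - analysis g n)"
  by (simp add: analysis_op_def ip_diff_right basis_mem)

lemma synthesis_diff:
  assumes c: "c \<in> l2" and d: "d \<in> l2"
  shows "synthesis (\<lambda>n. c n - d n) = (\<lambda>t. synthesis c t - synthesis d t)"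
proof (rule eq_of_ip_eq)
  note V = synthesis_limit(1)
  show "synthesis (\<lambda>n. c n - d n) \<in> V" "(\<lambda>t. synthesis c t - synthesis d t) \<in> V"
    by (intro V l2.diff_mem diff_mem c d)+
  fix h assume h: "h \<in> V"
  then show "ip h (synthesis (\<lambda>n. c n - d n)) = ip h (\<lambda>t. synthesis c t - synthesis d t)"
    by (simp add: ip_diff_right V c d ip_synthesis l2.diff_mem l2.ip_diff_right analysis_l2)
qed

lemma inj_on_synthesis: "inj_on synthesis l2"
proof (rule inj_onI)
  fix c d :: "nat \<Rightarrow> 'k" assume cd: "c \<in> l2" "d \<in> l2" and eq: "synthesis c = synthesis d"
  have "B1 * (l2_norm (\<lambda>n. c n - d n))\<^sup>2 \<le> 0"
    using synthesis_lower [OF l2.diff_mem [OF cd]]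
    by (simp add: synthesis_diff cd eq ip_norm_def ip_zero_right zero_mem)
  then have "l2_norm (\<lambda>n. c n - d n) = 0"
    using bounds by (simp add: mult_le_0_iff)
  then show "c = d"
    using l2.ip_norm_eq_0 [OF l2.diff_mem [OF cd]] by (simp add: fun_eq_iff)
qed

lemma inj_on_analysis: "inj_on analysis V"
proof (rule inj_onI)
  fix f g assume fg: "f \<in> V" "g \<in> V" and eq: "analysis f = analysis g"
  have "B1 * (ip_norm ip (\<lambda>t. f t - g t))\<^sup>2 \<le> 0"
    using analysis_lower [OF diff_mem [OF fg]]
    by (simp add: analysis_diff fg eq ip_norm_def l2.ip_zero_right l2.zero_mem)
  then have "ip_norm ip (\<lambda>t. f t - g t) = 0"
    using bounds by (simp add: mult_le_0_iff)
  then show "f = g"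
    using ip_norm_eq_0 [OF diff_mem [OF fg]] by (simp add: fun_eq_iff)
qed

text \<open>
  With \<open>S = T\<^sup>* T\<close> the square of the left-hand side is
  \<open>\<parallel>h\<parallel>\<^sup>2 - 2 \<tau> \<parallel>T h\<parallel>\<^sup>2 + \<tau>\<^sup>2 \<parallel>S h\<parallel>\<^sup>2 \<le> (1 - 2 \<tau> B1 + \<tau>\<^sup>2 B2\<^sup>2) \<parallel>h\<parallel>\<^sup>2\<close>; the chosen \<open>\<tau> = B1 / B2\<^sup>2\<close>
  minimizes the last factor.
\<close>

lemma frame_op_step_contraction:
  assumes h: "h \<in> V"
  shows "ip_norm ip (\<lambda>t. h t - of_real (B1 / B2\<^sup>2) * synthesis (analysis h) t)
    \<le> sqrt (1 - (B1 / B2)\<^sup>2) * ip_norm ip h"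
proof -
  define \<tau> where "\<tau> = B1 / B2\<^sup>2"
  define Sh where "Sh = synthesis (analysis h)"
  define x where "x = (l2_norm (analysis h))\<^sup>2"
  define k where "k = (\<lambda>t. h t - of_real \<tau> * Sh t)"
  have Th: "analysis h \<in> l2"
    by (rule analysis_l2 [OF h])
  have Sh: "Sh \<in> V"
    unfolding Sh_def by (rule synthesis_limit(1) [OF Th])
  have k: "k \<in> V"
    unfolding k_def by (rule diff_scale_mem [OF h Sh])
  have hSh: "ip h Sh = of_real x"
    unfolding Sh_def x_def by (simp only: ip_synthesis [OF Th h] l2.ip_self [OF Th])
  have Shh: "ip Sh h = of_real x"
    using ip_conjg [OF h Sh] by (simp only: hSh conjg_of_real)
  have hk: "ip h k = of_real ((ip_norm ip h)\<^sup>2 - \<tau> * x)"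
    unfolding k_def by (simp only: ip_diff_scale_right h Sh hSh ip_self of_real_diff of_real_mult)
  have Shk: "ip Sh k = of_real (x - \<tau> * (ip_norm ip Sh)\<^sup>2)"
    unfolding k_def by (simp only: ip_diff_scale_right h Sh Shh ip_self of_real_diff of_real_mult)
  have kh: "ip k h = of_real ((ip_norm ip h)\<^sup>2 - \<tau> * x)"
    using ip_conjg [OF h k] by (simp only: hk conjg_of_real)
  have kSh: "ip k Sh = of_real (x - \<tau> * (ip_norm ip Sh)\<^sup>2)"
    using ip_conjg [OF Sh k] by (simp only: Shk conjg_of_real)
  have "of_real ((ip_norm ip k)\<^sup>2) = ip k h - of_real \<tau> * ip k Sh"
    unfolding ip_self [OF k, symmetric]
    using ip_diff_scale_right [OF k h Sh, of "of_real \<tau>"] by (simp only: k_def)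
  then have "of_real ((ip_norm ip k)\<^sup>2)
      = (of_real ((ip_norm ip h)\<^sup>2 - \<tau> * x - \<tau> * (x - \<tau> * (ip_norm ip Sh)\<^sup>2)) :: 'k)"
    unfolding kh kSh by (simp only: of_real_diff of_real_mult)
  then have "(ip_norm ip k)\<^sup>2 = (ip_norm ip h)\<^sup>2 - 2 * \<tau> * x + \<tau>\<^sup>2 * (ip_norm ip Sh)\<^sup>2"
    unfolding of_real_eq_iff by (simp add: power2_eq_square algebra_simps)
  also have "\<dots> \<le> (ip_norm ip h)\<^sup>2 - 2 * \<tau> * (B1 * (ip_norm ip h)\<^sup>2)
      + \<tau>\<^sup>2 * (B2 * (B2 * (ip_norm ip h)\<^sup>2))"
  proof (intro add_mono diff_mono order_refl mult_left_mono)
    show "B1 * (ip_norm ip h)\<^sup>2 \<le> x"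
      unfolding x_def by (rule analysis_lower [OF h])
    have "(ip_norm ip Sh)\<^sup>2 \<le> B2 * x"
      unfolding Sh_def x_def by (rule synthesis_upper [OF Th])
    also have "\<dots> \<le> B2 * (B2 * (ip_norm ip h)\<^sup>2)"
      unfolding x_def using bounds by (intro mult_left_mono analysis_upper [OF h]) simp
    finally show "(ip_norm ip Sh)\<^sup>2 \<le> B2 * (B2 * (ip_norm ip h)\<^sup>2)" .
  qed (use bounds in \<open>simp_all add: \<tau>_def\<close>)
  also have "\<dots> = (1 - (B1 / B2)\<^sup>2) * (ip_norm ip h)\<^sup>2"
    using bounds by (simp add: \<tau>_def field_simps power2_eq_square)
  finally have "sqrt ((ip_norm ip k)\<^sup>2) \<le> sqrt ((1 - (B1 / B2)\<^sup>2) * (ip_norm ip h)\<^sup>2)"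
    by (rule real_sqrt_le_mono)
  then show ?thesis
    by (simp add: real_sqrt_mult k_def \<tau>_def Sh_def)
qed

text \<open>
  Fixed points of \<open>f \<mapsto> f - \<tau> (S f - y)\<close> are the solutions of \<open>S f = y\<close>, and this map is a contraction
  of a complete space.
\<close>

lemma frame_op_surj:
  assumes y: "y \<in> V"
  obtains f where "f \<in> V" and "synthesis (analysis f) = y"
proof -
  interpret M: Metric_space V "ip_dist V ip"
    by (rule Metric_space_ip_dist)
  define \<tau> :: 'k where "\<tau> = of_real (B1 / B2\<^sup>2)"
  define \<Phi> where "\<Phi> = (\<lambda>f t. f t - \<tau> * (synthesis (analysis f) t - y t))"
  have S: "synthesis (analysis f) \<in> V" if "f \<in> V" for f
    by (intro synthesis_limit(1) analysis_l2 that)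
  have \<Phi>: "\<Phi> f \<in> V" if "f \<in> V" for f
    unfolding \<Phi>_def by (intro diff_scale_mem diff_mem S that y)
  have "ip_dist V ip (\<Phi> f) (\<Phi> g) \<le> sqrt (1 - (B1 / B2)\<^sup>2) * ip_dist V ip f g"
    if fg: "f \<in> V" "g \<in> V" for f g
  proof -
    have "synthesis (analysis (\<lambda>t. f t - g t))
        = (\<lambda>t. synthesis (analysis f) t - synthesis (analysis g) t)"
      by (simp add: analysis_diff synthesis_diff analysis_l2 fg)
    then have "(\<lambda>t. \<Phi> f t - \<Phi> g t)
        = (\<lambda>t. (f t - g t) - \<tau> * synthesis (analysis (\<lambda>t. f t - g t)) t)"
      by (simp only: \<Phi>_def) (simp add: algebra_simps)
    then show ?thesis
      using frame_op_step_contraction [OF diff_mem [OF fg]]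
      by (simp add: ip_dist_def \<Phi> fg \<tau>_def)
  qed
  then obtain f where f: "f \<in> V" and fix_f: "\<Phi> f = f"
    using M.Banach_fixedpoint_thm [OF complete, of \<Phi> "sqrt (1 - (B1 / B2)\<^sup>2)"] y \<Phi> bounds
    by auto
  have "\<tau> \<noteq> 0"
    using bounds by (simp add: \<tau>_def)
  with fix_f have "synthesis (analysis f) = y"
    by (simp add: \<Phi>_def fun_eq_iff)
  with f show ?thesis
    by (rule that)
qed

lemma bij_betw_synthesis: "bij_betw synthesis l2 V"
proof -
  have "y \<in> synthesis ` l2" if y: "y \<in> V" for y
  proof -
    obtain f where "f \<in> V" and "synthesis (analysis f) = y"
      by (rule frame_op_surj [OF y])
    then show ?thesis
      using analysis_l2 by blast
  qed
  then have "synthesis ` l2 = V"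
    using synthesis_limit(1) by blast
  then show ?thesis
    by (simp add: bij_betw_def inj_on_synthesis)
qed

text \<open>
  Surjectivity comes from the frame operator and the injectivity of \<open>T\<^sup>*\<close>: if \<open>T\<^sup>* T f = T\<^sup>* d\<close> then
  \<open>T f = d\<close>.
\<close>

lemma bij_betw_analysis: "bij_betw analysis V l2"
proof -
  have "d \<in> analysis ` V" if d: "d \<in> l2" for d
  proof -
    obtain f where f: "f \<in> V" and eq: "synthesis (analysis f) = synthesis d"
      using frame_op_surj [OF synthesis_limit(1) [OF d]] .
    have "analysis f = d"
      using inj_onD [OF inj_on_synthesis eq analysis_l2 [OF f] d] .
    with f show ?thesis
      by blast
  qed
  then have "analysis ` V = l2"
    using analysis_l2 by blast
  then show ?thesis
    by (simp add: bij_betw_def inj_on_analysis)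
qed


section \<open>The Gramian as an operator in the sequence space\<close>

abbreviation G :: "nat \<Rightarrow> nat \<Rightarrow> 'k" where
  "G \<equiv> gramian ip \<phi>"

text \<open>
  The rows of the Gramian applied to \<open>c\<close> are the coefficients of \<open>T\<^sup>* c\<close>; thus \<open>G = T T\<^sup>*\<close>, with all of
  \<open>l\<^sup>2\<close> as its maximal domain.
\<close>

lemma gramian_row_sums:
  assumes "c \<in> l2"
  shows "(\<lambda>j. G k j * c j) sums analysis (synthesis c) k"
  using ip_synthesis_sums [OF assms basis_mem, of k]
  by (simp add: gramian_def analysis_op_def mult.commute)

lemma matrix_op_gramian: "c \<in> l2 \<Longrightarrow> matrix_op G c = analysis (synthesis c)"
  using gramian_row_sums [THEN sums_unique] by (simp add: matrix_op_def fun_eq_iff)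

lemma matrix_dom_gramian: "matrix_dom G = l2"
  using gramian_row_sums [THEN sums_summable]
  by (auto simp: matrix_dom_def matrix_op_gramian analysis_l2 synthesis_limit(1))

lemma bij_betw_gramian: "bij_betw (matrix_op G) l2 l2"
proof -
  have "bij_betw (analysis \<circ> synthesis) l2 l2"
    by (rule bij_betw_trans [OF bij_betw_synthesis bij_betw_analysis])
  then show ?thesis
    by (rule bij_betw_cong [THEN iffD1, rotated]) (simp add: matrix_op_gramian)
qed

lemma gramian_symmetric:
  assumes "c \<in> l2" and "d \<in> l2"
  shows "l2_ip d (matrix_op G c) = l2_ip (matrix_op G d) c"
proof -
  note V = synthesis_limit(1) [OF assms(1)] synthesis_limit(1) [OF assms(2)]
  have "l2_ip d (matrix_op G c) = conjg (l2_ip (analysis (synthesis c)) d)"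
    unfolding matrix_op_gramian [OF assms(1)]
    by (rule l2.ip_conjg [OF analysis_l2 [OF V(1)] assms(2)])
  also have "\<dots> = conjg (ip (synthesis c) (synthesis d))"
    by (simp only: ip_synthesis [OF assms(2) V(1)])
  also have "\<dots> = ip (synthesis d) (synthesis c)"
    by (rule ip_conjg [OF V, symmetric])
  also have "\<dots> = l2_ip (matrix_op G d) c"
    by (simp only: ip_synthesis [OF assms(1) V(2)] matrix_op_gramian [OF assms(2)])
  finally show ?thesis .
qed

lemma matrix_op_gramian_mem: "c \<in> l2 \<Longrightarrow> matrix_op G c \<in> l2"
  using bij_betwE [OF bij_betw_gramian] by blast

lemma fun_linear_on_gramian: "fun_linear_on l2 (matrix_op G)"
  unfolding fun_linear_on_def
proof (intro conjI ballI allI)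
  note summable = gramian_row_sums [THEN sums_summable]
  fix c d :: "nat \<Rightarrow> 'k" assume cd: "c \<in> l2" "d \<in> l2"
  show "matrix_op G (\<lambda>n. c n + d n) = (\<lambda>n. matrix_op G c n + matrix_op G d n)"
    by (simp add: matrix_op_def distrib_left suminf_add summable cd)
next
  fix a and c :: "nat \<Rightarrow> 'k" assume c: "c \<in> l2"
  show "matrix_op G (\<lambda>n. a * c n) = (\<lambda>n. a * matrix_op G c n)"
    unfolding matrix_op_def mult.left_commute [of _ a]
    by (simp add: suminf_mult gramian_row_sums [THEN sums_summable] c)
qed

text \<open>
  Since the domain is all of \<open>l\<^sup>2\<close>, density is trivial and an adjoint pair \<open>(d, e)\<close> can be compared with
  \<open>(d, G d)\<close> on every vector; symmetry then forces \<open>e = G d\<close>.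
\<close>

lemma selfadjoint_gramian: "selfadjoint_operator l2 l2_ip (matrix_dom G) (matrix_op G)"
  unfolding selfadjoint_operator_def matrix_dom_gramian
proof (intro conjI)
  show "(ip_topology l2 l2_ip) closure_of l2 = (l2 :: (nat \<Rightarrow> 'k) set)"
    using closure_of_topspace [of "ip_topology l2 l2_ip :: (nat \<Rightarrow> 'k) topology"]
    by (simp add: Metric_space.topspace_mtopology [OF l2.Metric_space_ip_dist])
  have "e = matrix_op G d"
    if d: "d \<in> l2" and e: "e \<in> l2" and adj: "\<forall>c\<in>l2. l2_ip d (matrix_op G c) = l2_ip e c" for d e
  proof (rule l2.eq_of_ip_eq [OF e matrix_op_gramian_mem [OF d]])
    fix c :: "nat \<Rightarrow> 'k" assume c: "c \<in> l2"
    have "l2_ip e c = l2_ip (matrix_op G d) c"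
      using adj gramian_symmetric [OF c d] c by simp
    then show "l2_ip c e = l2_ip c (matrix_op G d)"
      using l2.ip_conjg [OF e c] l2.ip_conjg [OF matrix_op_gramian_mem [OF d] c] by simp
  qed
  then show "adjoint_graph l2 l2_ip l2 (matrix_op G) = (\<lambda>c. (c, matrix_op G c)) ` l2"
    by (auto simp: adjoint_graph_def matrix_op_gramian_mem gramian_symmetric)
qed (auto simp: fun_subspace_l2 fun_linear_on_gramian matrix_op_gramian_mem)

text \<open>
  With \<open>\<kappa>\<close> the entrywise conjugation of sequences, the conjugated matrix acts as \<open>\<kappa> G \<kappa>\<close>. So its
  domain and bijectivity are inherited from \<open>G\<close>.
\<close>

lemma conjg_gramian_row_sums:
  assumes "c \<in> l2"
  shows "(\<lambda>j. matrix_conjg G k j * c j) sums conjg (matrix_op G (\<lambda>n. conjg (c n)) k)"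
  using bounded_linear.sums [OF bounded_linear_conjg gramian_row_sums [OF l2_conjg [OF assms]], of k]
  by (simp add: matrix_conjg_def conjg_mult matrix_op_gramian l2_conjg assms)

lemma matrix_op_conjg_gramian:
  "c \<in> l2 \<Longrightarrow> matrix_op (matrix_conjg G) c = (\<lambda>k. conjg (matrix_op G (\<lambda>n. conjg (c n)) k))"
  using conjg_gramian_row_sums [THEN sums_unique] by (simp add: matrix_op_def fun_eq_iff)

lemma matrix_dom_conjg_gramian: "matrix_dom (matrix_conjg G) = l2"
  using conjg_gramian_row_sums [THEN sums_summable]
  by (auto simp: matrix_dom_def matrix_op_conjg_gramian matrix_op_gramian_mem l2_conjg)

lemma bij_betw_conjg_gramian:
  "bij_betw (matrix_op (matrix_conjg G)) (matrix_dom (matrix_conjg G)) l2"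
proof -
  let ?\<kappa> = "\<lambda>(c :: nat \<Rightarrow> 'k) n. conjg (c n)"
  have \<kappa>: "bij_betw ?\<kappa> l2 l2"
    by (rule bij_betw_byWitness [where f' = ?\<kappa>]) (auto intro: l2_conjg)
  have "bij_betw (?\<kappa> \<circ> (matrix_op G \<circ> ?\<kappa>)) l2 l2"
    by (intro bij_betw_trans [OF _ \<kappa>] bij_betw_trans [OF \<kappa> bij_betw_gramian])
  then show ?thesis
    unfolding matrix_dom_conjg_gramian
    by (rule bij_betw_cong [THEN iffD1, rotated]) (simp add: matrix_op_conjg_gramian)
qed


section \<open>The reproducing kernel\<close>

context
  assumes l2_values: "\<And>t. (\<lambda>n. \<phi> n t) \<in> l2"
    and pointwise: "\<And>c. c \<in> l2 \<Longrightarrow> synthesis c = pointwise_sum \<phi> c"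
begin

text \<open>
  The representer \<open>k t\<close> has to satisfy \<open>\<Sum>\<^sub>n conjg (T (k t))\<^sub>n e\<^sub>n = \<Sum>\<^sub>n \<phi>\<^sub>n(t) e\<^sub>n\<close> for all \<open>e\<close>, that is,
  \<open>T (k t)\<close> must be the conjugate of \<open>l t\<close>. Writing \<open>k t = T\<^sup>* c\<close> this reads \<open>G c = conjg (l t)\<close>, or
  equivalently that the conjugate of \<open>c\<close> is the inverse of the conjugated Gramian applied to \<open>l t\<close>.
\<close>

lemma rkhs_gram_kernel: "rkhs_with_kernel V ip (gram_kernel ip \<phi>)"
proof -
  define l where "l = (\<lambda>t n. \<phi> n t)"
  have l: "l t \<in> l2" for t
    unfolding l_def by (rule l2_values)
  define d where "d = (\<lambda>t. matrix_inverse (matrix_conjg G) (l t))"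
  have d: "d t \<in> l2" for t
    using bij_betw_conjg_gramian l [of t]
    unfolding d_def matrix_inverse_def matrix_dom_conjg_gramian
    by (simp add: bij_betw_def inv_into_into)
  have Gd: "matrix_op (matrix_conjg G) (d t) = l t" for t
    using bij_betw_inv_into_right [OF bij_betw_conjg_gramian l, of t]
    by (simp only: d_def matrix_inverse_def)
  define k where "k = (\<lambda>t. synthesis (\<lambda>n. conjg (d t n)))"
  have k: "k t \<in> V" for t
    unfolding k_def by (rule synthesis_limit(1) [OF l2_conjg [OF d]])
  have analysis_k: "analysis (k t) = (\<lambda>n. conjg (l t n))" for t
  proof -
    have "analysis (k t) = matrix_op G (\<lambda>n. conjg (d t n))"
      unfolding k_def by (simp only: matrix_op_gramian l2_conjg [OF d])
    also have "\<dots> = (\<lambda>n. conjg (matrix_op (matrix_conjg G) (d t) n))"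
      by (simp add: matrix_op_conjg_gramian d)
    finally show ?thesis
      by (simp only: Gd)
  qed
  have reproducing: "f t = ip (k t) f" if f: "f \<in> V" for f t
  proof -
    obtain e where e: "e \<in> l2" and f_e: "f = synthesis e"
      using f bij_betw_imp_surj_on [OF bij_betw_synthesis] by blast
    have "ip (k t) f = (\<Sum>n. l t n * e n)"
      unfolding f_e by (simp add: ip_synthesis e k analysis_k l2_ip_def)
    also have "\<dots> = f t"
      unfolding f_e pointwise [OF e] by (simp add: pointwise_sum_def l_def mult.commute)
    finally show ?thesis
      by simp
  qed
  have "k t s = gram_kernel ip \<phi> t s" for t s
  proof -
    \<comment> \<open>Pointwise evaluation of \<open>k t\<close> puts the inverse on the first argument of \<open>l2_ip\<close>; Hermitian
        symmetry of the kernel moves it to the second one, as in \<open>gram_kernel\<close>.\<close>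
    have "k t s = conjg (k s t)"
      unfolding reproducing [OF k, of s t] reproducing [OF k, of t s] by (rule ip_conjg [OF k k])
    also have "k s t = l2_ip (d s) (l t)"
      unfolding k_def pointwise [OF l2_conjg [OF d]] by (simp add: pointwise_sum_def l2_ip_def l_def)
    also have "conjg \<dots> = l2_ip (l t) (d s)"
      by (rule l2.ip_conjg [OF d l, symmetric])
    finally show ?thesis
      by (simp add: gram_kernel_def d_def l_def)
  qed
  then have "gram_kernel ip \<phi> = k"
    by (simp add: fun_eq_iff)
  moreover have "rkhs_with_kernel V ip k"
    using k reproducing complete inner_product_function_space_axioms
    by (intro rkhs_with_kernelI) (simp_all add: hilbert_function_space_def)
  ultimately show ?thesis
    by simp
qed

end

end

theorem theorem1:
  fixes H :: "('o \<Rightarrow> 'k::real_or_complex) set"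
    and ip :: "('o \<Rightarrow> 'k) \<Rightarrow> ('o \<Rightarrow> 'k) \<Rightarrow> 'k"
    and \<phi> :: "nat \<Rightarrow> ('o \<Rightarrow> 'k)"
  assumes hilbert: "hilbert_function_space H ip"
    and separable: "separable_space (ip_topology H ip)"
    and frame: "frame H ip \<phi>"
    and l2_values: "\<forall>t. (\<lambda>n. \<phi> n t) \<in> l2"
    and pointwise: "\<forall>c\<in>l2. synthesis_op H ip \<phi> c = pointwise_sum \<phi> c"
  shows "bij_betw (matrix_op (matrix_conjg (gramian ip \<phi>)))
           (matrix_dom (matrix_conjg (gramian ip \<phi>))) l2 \<and>
         rkhs_with_kernel H ip (gram_kernel ip \<phi>) \<and>
         selfadjoint_operator l2 l2_ip (matrix_dom (gramian ip \<phi>)) (matrix_op (gramian ip \<phi>)) \<and>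
         (\<forall>HRK ipRK. rkhs_with_kernel HRK ipRK (gram_kernel ip \<phi>) \<longrightarrow>
            HRK = pointwise_sum \<phi> ` l2 \<and>
            (\<exists>TG. isometric_isomorphism HRK ipRK H ip TG \<and>
                  (\<forall>c\<in>l2. TG (pointwise_sum \<phi> c) = synthesis_op H ip \<phi> c)))"
proof -
  obtain B1 B2 where "riesz_basis H ip \<phi> B1 B2"
    using hilbert frame
    unfolding hilbert_function_space_def frame_def riesz_basis_def riesz_basis_axioms_def by blast
  then interpret riesz_basis H ip \<phi> B1 B2 .
  have kernel: "rkhs_with_kernel H ip (gram_kernel ip \<phi>)"
    using l2_values pointwise by (intro rkhs_gram_kernel) blast+
  have H: "H = pointwise_sum \<phi> ` l2"
    using bij_betw_imp_surj_on [OF bij_betw_synthesis] pointwise by auto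
  have "HRK = pointwise_sum \<phi> ` l2 \<and>
      (\<exists>TG. isometric_isomorphism HRK ipRK H ip TG \<and>
            (\<forall>c\<in>l2. TG (pointwise_sum \<phi> c) = synthesis_op H ip \<phi> c))"
    if HRK: "rkhs_with_kernel HRK ipRK (gram_kernel ip \<phi>)" for HRK ipRK
  proof (intro conjI exI)
    note unique = rkhs_with_kernel_unique [OF HRK kernel]
    show "HRK = pointwise_sum \<phi> ` l2"
      using unique(1) H by simp
    \<comment> \<open>\<open>HRK\<close> and \<open>H\<close> coincide with equal norms, and both expansions denote the same function.\<close>
    show "isometric_isomorphism HRK ipRK H ip (\<lambda>f. f)"
      using unique by (simp add: isometric_isomorphism_def fun_linear_on_def bij_betw_def inj_on_def)
    show "\<forall>c\<in>l2. pointwise_sum \<phi> c = synthesis_op H ip \<phi> c"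
      using pointwise by simp
  qed
  with kernel show ?thesis
    using bij_betw_conjg_gramian selfadjoint_gramian by blast
qed

end
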